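(* Let $p=1$ and $0\le l\le L-1$. Then for all $\mu\in M_l^0$, $$\hat a_L(I_l\mu,I_l\mu)\le C\,\hat a_l(\mu,\mu),$$ with $C$ independent of the mesh sizes and of the levels.
   Context: $\Omega\subset\mathbb R^2$ polygonal; $\{\mathcal T_l\}_{l=0}^L$ a shape-regular family of nested conforming quasi-uniform triangulations ($\mathcal T_l$ refines $\mathcal T_{l-1}$) with mesh sizes $h_l$, edge sets $\mathcal E_l$, vertex sets $\mathcal V_l$. Here $p=1$: $\boldsymbol V(T)=(\mathcal P_1(T))^2$, $W(T)=\mathcal P_1(T)$; $M_l$ = functions on $\cup\mathcal E_l$ linear on each edge, $M_l^0=\{\mu\in M_l:\mu|_{\partial\Omega}=0\}$; $W_l^c$ = continuous piecewise linear functions on $\mathcal T_l$. On level $l$, $\tau_l>0$ with $c_1h_l^{-1}\le\tau_l\le c_2h_l^{-1}$. Local solver on level $l$: for $T\in\mathcal T_l$, $m\in L^2(\partial T)$, $(\boldsymbol Q_m,U_m)\in\boldsymbol V(T)\times W(T)$ solves $(\boldsymbol Q_m,\boldsymbol v)_T-(U_m,\operatorname{div}\boldsymbol v)_T=-\langle m,\boldsymbol v\cdot\boldsymbol n\rangle_{\partial T}$ and $-(\boldsymbol Q_m,\nabla w)_T+\langle \boldsymbol Q_m\cdot\boldsymbol n+\tau_l(U_m-m),w\rangle_{\partial T}=0$ for all $(\boldsymbol v,w)$; for $\mu\in M_l$ it is applied elementwise with $m=\mu|_{\partial T}$. Energy form: $\hat a_l(\lambda,\mu)=\sum_{T\in\mathcal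 T_l}[(\boldsymbol Q_\lambda,\boldsymbol Q_\mu)_T+\tau_l\langle U_\lambda-\lambda,U_\mu-\mu\rangle_{\partial T}]$. $I_l^W:M_l\to W_l^c$: $I_l^W\lambda(z)=\frac{1}{|\mathcal E_l(z)|}\sum_{e\in\mathcal E_l(z)}\lambda_e(z)$ for each vertex $z\in\mathcal V_l$, $\mathcal E_l(z)$ being the edges containing $z$ and $\lambda_e=\lambda|_e$. Intergrid transfer $I_l:M_l\to M_L$: $I_l\mu:=(I_l^W\mu)|_{\cup\mathcal E_L}$. *)

theory Defs
  imports "HOL-Analysis.Analysis"
begin

type_synonym pt = "real^2"

text \<open>A triangle is represented by its set of three (non-collinear) vertices;
  the closed element is its convex hull.\<close>
definition triangle :: "pt set \<Rightarrow> bool" where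
  "triangle T \<longleftrightarrow> card T = 3 \<and> \<not> collinear T"

definition tri_edges :: "pt set \<Rightarrow> pt set set" where
  "tri_edges T = {e. e \<subseteq> T \<and> card e = 2}"

definition edges :: "pt set set \<Rightarrow> pt set set" where
  "edges Th = (\<Union>T\<in>Th. tri_edges T)"

definition vertices :: "pt set set \<Rightarrow> pt set" where
  "vertices Th = \<Union>Th"

definition edges_at :: "pt set set \<Rightarrow> pt \<Rightarrow> pt set set" where
  "edges_at Th z = {e \<in> edges Th. z \<in> e}"

definition polygonal_domain :: "pt set \<Rightarrow> bool" where
  "polygonal_domain \<Omega> \<longleftrightarrow> open \<Omega> \<and> bounded \<Omega> \<and> connected \<Omega> \<and> \<Omega> \<noteq> {}
     \<and> interior (closure \<Omega>) = \<Omega>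
     \<and> (\<exists>P. finite P \<and> (\<forall>s\<in>P. \<exists>a b. a \<noteq> b \<and> s = closed_segment a b) \<and> frontier \<Omega> = \<Union>P)"

definition conforming_triangulation :: "pt set \<Rightarrow> pt set set \<Rightarrow> bool" where
  "conforming_triangulation \<Omega> Th \<longleftrightarrow> finite Th \<and> Th \<noteq> {} \<and> (\<forall>T\<in>Th. triangle T)
     \<and> (\<Union>T\<in>Th. convex hull T) = closure \<Omega>
     \<and> (\<forall>T\<in>Th. \<forall>T'\<in>Th. T \<noteq> T' \<longrightarrow> convex hull T \<inter> convex hull T' = convex hull (T \<inter> T'))"

definition refines :: "pt set set \<Rightarrow> pt set set \<Rightarrow> bool" where
  "refines Th' Th \<longleftrightarrow> (\<forall>T'\<in>Th'. \<exists>T\<in>Th. convex hull T' \<subseteq> convex hull T)"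

definition elem_diam :: "pt set \<Rightarrow> real" where
  "elem_diam T = diameter (convex hull T)"

definition inradius :: "pt set \<Rightarrow> real" where
  "inradius T = Sup {r. r \<ge> 0 \<and> (\<exists>x. ball x r \<subseteq> convex hull T)}"

definition mesh_size :: "pt set set \<Rightarrow> real" where
  "mesh_size Th = Max (elem_diam ` Th)"

definition shape_regular :: "real \<Rightarrow> pt set set \<Rightarrow> bool" where
  "shape_regular \<sigma> Th \<longleftrightarrow> (\<forall>T\<in>Th. elem_diam T \<le> \<sigma> * inradius T)"

definition quasi_uniform :: "real \<Rightarrow> pt set set \<Rightarrow> bool" where
  "quasi_uniform \<kappa> Th \<longleftrightarrow> (\<forall>T\<in>Th. mesh_size Th \<le> \<kappa> * elem_diam T)"

definition elem_int :: "pt set \<Rightarrow> (pt \<Rightarrow> real) \<Rightarrow> real" where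
  "elem_int T f = (LINT x : convex hull T | lborel. f x)"

definition edge_pts :: "pt set \<Rightarrow> pt \<times> pt" where
  "edge_pts e = (SOME p. e = {fst p, snd p} \<and> fst p \<noteq> snd p)"

definition edge_int :: "pt set \<Rightarrow> (pt \<Rightarrow> real) \<Rightarrow> real" where
  "edge_int e f = (case edge_pts e of (a, b) \<Rightarrow>
      dist a b * (LINT t : {0..1} | lborel. f ((1 - t) *\<^sub>R a + t *\<^sub>R b)))"

definition rot90 :: "pt \<Rightarrow> pt" where
  "rot90 v = vector [- (v $ 2), v $ 1]"

definition outer_normal :: "pt set \<Rightarrow> pt set \<Rightarrow> pt" where
  "outer_normal T e = (case edge_pts e of (a, b) \<Rightarrow>
      (let c = (THE c. c \<in> T - e); r = rot90 (b - a) in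
        if r \<bullet> (c - a) < 0 then (1 / norm r) *\<^sub>R r else (- 1 / norm r) *\<^sub>R r))"

text \<open>\<open>\<langle>g, 1\<rangle>_{\<partial>T}\<close> where the integrand may depend on the edge (trace / normal).\<close>
definition bdry_int :: "pt set \<Rightarrow> (pt set \<Rightarrow> pt \<Rightarrow> real) \<Rightarrow> real" where
  "bdry_int T g = (\<Sum>e\<in>tri_edges T. edge_int e (g e))"

definition P1 :: "(pt \<Rightarrow> real) set" where
  "P1 = {w. \<exists>a c. \<forall>x. w x = a \<bullet> x + c}"

definition P1vec :: "(pt \<Rightarrow> pt) set" where
  "P1vec = {v. \<exists>(A::real^2^2) b. \<forall>x. v x = A *v x + b}"

definition vdiv :: "(pt \<Rightarrow> pt) \<Rightarrow> pt \<Rightarrow> real" where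
  "vdiv v x = (\<Sum>i\<in>UNIV. frechet_derivative v (at x) (axis i 1) $ i)"

definition grad :: "(pt \<Rightarrow> real) \<Rightarrow> pt \<Rightarrow> pt" where
  "grad w x = (\<chi> i. frechet_derivative w (at x) (axis i 1))"

definition local_eqs :: "real \<Rightarrow> pt set \<Rightarrow> (pt set \<Rightarrow> pt \<Rightarrow> real)
    \<Rightarrow> (pt \<Rightarrow> pt) \<Rightarrow> (pt \<Rightarrow> real) \<Rightarrow> bool" where
  "local_eqs \<tau> T m Q U \<longleftrightarrow> Q \<in> P1vec \<and> U \<in> P1 \<and>
     (\<forall>v\<in>P1vec. elem_int T (\<lambda>x. Q x \<bullet> v x) - elem_int T (\<lambda>x. U x * vdiv v x)
        = - bdry_int T (\<lambda>e x. m e x * (v x \<bullet> outer_normal T e))) \<and>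
     (\<forall>w\<in>P1. - elem_int T (\<lambda>x. Q x \<bullet> grad w x)
        + bdry_int T (\<lambda>e x. (Q x \<bullet> outer_normal T e + \<tau> * (U x - m e x)) * w x) = 0)"

definition local_solver :: "real \<Rightarrow> pt set \<Rightarrow> (pt set \<Rightarrow> pt \<Rightarrow> real) \<Rightarrow> (pt \<Rightarrow> pt) \<times> (pt \<Rightarrow> real)" where
  "local_solver \<tau> T m = (THE p. local_eqs \<tau> T m (fst p) (snd p))"

definition lsQ :: "real \<Rightarrow> pt set \<Rightarrow> (pt set \<Rightarrow> pt \<Rightarrow> real) \<Rightarrow> pt \<Rightarrow> pt" where
  "lsQ \<tau> T m = fst (local_solver \<tau> T m)"

definition lsU :: "real \<Rightarrow> pt set \<Rightarrow> (pt set \<Rightarrow> pt \<Rightarrow> real) \<Rightarrow> pt \<Rightarrow> real" where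
  "lsU \<tau> T m = snd (local_solver \<tau> T m)"

text \<open>Energy form \<open>\<hat>a\<close> on a level with mesh \<open>Th\<close> and stabilization \<open>\<tau>\<close>.
  Elements of the trace spaces are edge-indexed: \<open>lam e\<close> is \<open>lam|_e\<close>.\<close>
definition ahat :: "real \<Rightarrow> pt set set \<Rightarrow> (pt set \<Rightarrow> pt \<Rightarrow> real) \<Rightarrow> (pt set \<Rightarrow> pt \<Rightarrow> real) \<Rightarrow> real" where
  "ahat \<tau> Th lam mu = (\<Sum>T\<in>Th. elem_int T (\<lambda>x. lsQ \<tau> T lam x \<bullet> lsQ \<tau> T mu x)
      + \<tau> * bdry_int T (\<lambda>e x. (lsU \<tau> T lam x - lam e x) * (lsU \<tau> T mu x - mu e x)))"

definition Mspace :: "pt set set \<Rightarrow> (pt set \<Rightarrow> pt \<Rightarrow> real) set" where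
  "Mspace Th = {mu. \<forall>e\<in>edges Th. \<exists>a c. \<forall>x\<in>convex hull e. mu e x = a \<bullet> x + c}"

definition M0space :: "pt set \<Rightarrow> pt set set \<Rightarrow> (pt set \<Rightarrow> pt \<Rightarrow> real) set" where
  "M0space \<Omega> Th = {mu \<in> Mspace Th. \<forall>e\<in>edges Th.
      convex hull e \<subseteq> frontier \<Omega> \<longrightarrow> (\<forall>x\<in>convex hull e. mu e x = 0)}"

definition IW_nodal :: "pt set set \<Rightarrow> (pt set \<Rightarrow> pt \<Rightarrow> real) \<Rightarrow> pt \<Rightarrow> real" where
  "IW_nodal Th mu z = (\<Sum>e\<in>edges_at Th z. mu e z) / real (card (edges_at Th z))"

definition aff_interp :: "pt set \<Rightarrow> (pt \<Rightarrow> real) \<Rightarrow> pt \<Rightarrow> real" where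
  "aff_interp T g x = (THE v. \<exists>a c. (\<forall>z\<in>T. g z = a \<bullet> z + c) \<and> v = a \<bullet> x + c)"

definition p1_interp :: "pt set set \<Rightarrow> (pt \<Rightarrow> real) \<Rightarrow> pt \<Rightarrow> real" where
  "p1_interp Th g x = (THE v. \<exists>T\<in>Th. x \<in> convex hull T \<and> v = aff_interp T g x)"

definition IW :: "pt set set \<Rightarrow> (pt set \<Rightarrow> pt \<Rightarrow> real) \<Rightarrow> pt \<Rightarrow> real" where
  "IW Th mu = p1_interp Th (IW_nodal Th mu)"

text \<open>\<open>I_l \<mu> = (I_l^W \<mu>)|_{\<Union>E_L}\<close>: same (continuous) function on every fine edge.\<close>
definition transfer :: "pt set set \<Rightarrow> (pt set \<Rightarrow> pt \<Rightarrow> real) \<Rightarrow> pt set \<Rightarrow> pt \<Rightarrow> real" where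
  "transfer Th mu = (\<lambda>e x. IW Th mu x)"

end

theory Submission
  imports Defs
begin

text \<open>
  On a fine element the transferred function is affine, so the local solver returns minus its
  gradient and the function itself, without stabilization: the fine energy is the Dirichlet energy
  of the continuous interpolant \<open>I_l^W \<mu>\<close>, which is computed on the coarse mesh.

  On a coarse element \<open>T\<close> with local energy \<open>E_T\<close>, testing the first equation with \<open>\<nabla>U\<close> bounds
  \<open>|T| |\<nabla>U|\<^sup>2\<close> by \<open>E_T\<close>, and an inverse inequality on the edges bounds \<open>|U - \<mu>_e|\<^sup>2\<close> at the vertices
  by \<open>E_T\<close>. Walking around a vertex \<open>z\<close> through common edges therefore compares all edge traces
  \<open>\<mu>_e(z)\<close>, hence their average, with \<open>U(z)\<close>. The star of \<open>z\<close> need not be connected through edges,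
  since \<open>\<Omega>\<close> may touch itself at \<open>z\<close>; but then every component of the star has an edge on the
  boundary, where \<open>\<mu>\<close> vanishes, and the comparison goes through zero.
\<close>

section \<open>Oriented triangles\<close>

text \<open>In the plane |T| |grad w|^2 is invariant under scaling, so vertex values control it with
  no power of the mesh size. The stabilization supplies the vertex values: on a coarse element
  \<tau> times the diameter is at least \<open>\<gamma> = c1 / \<kappa>\<close>, which turns \<tau>
  times an edge integral into a pointwise bound. The other ingredient is the bound
  \<open>N = 8 * \<sigma>\<^sup>2 * \<kappa>\<^sup>2\<close> on the number of triangles at a vertex,
  found by comparing areas; a walk around the vertex then takes at most \<open>N\<^sup>2\<close>
  steps. Three obstacles shape the text. The local solver and the interpolant are definite
  descriptions, about which nothing is known before existence and uniqueness; for the solver these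
  come from a definite bilinear form on polynomial coefficients. The divergence theorem is obtained
  by exact quadrature, which leaves a polynomial identity in the vertex coordinates. The neighbour
  of a triangle across an inner edge is not part of the definition of a conforming mesh and has to
  be derived from the covering of the closure of the open set \<Omega>.\<close>

definition orient :: "pt \<Rightarrow> pt \<Rightarrow> pt \<Rightarrow> real" where
  "orient a b c = (b $ 1 - a $ 1) * (c $ 2 - a $ 2) - (b $ 2 - a $ 2) * (c $ 1 - a $ 1)"

lemma orient_rotate: "orient b c a = orient a b c"
  by (simp add: orient_def algebra_simps)

lemma orient_swap: "orient b a c = - orient a b c"
  by (simp add: orient_def algebra_simps)

lemma orient_same [simp]: "orient a b a = 0" "orient a b b = 0" "orient a a b = 0"
  by (simp_all add: orient_def)

lemma continuous_on_orient [continuous_intros]: "continuous_on S (orient a b)"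
  unfolding orient_def by (intro continuous_intros)

lemma orient_affine:
  "u + v + w = 1 \<Longrightarrow>
    orient p q (u *\<^sub>R x + v *\<^sub>R y + w *\<^sub>R z) = u * orient p q x + v * orient p q y + w * orient p q z"
proof -
  assume "u + v + w = 1"
  then have u: "u = 1 - v - w" by simp
  show ?thesis unfolding orient_def u by (simp add: algebra_simps)
qed

lemma orient_sum: "orient b c w + orient c a w + orient a b w = orient a b c"
  by (simp add: orient_def algebra_simps)

text \<open>\<open>orient a b c\<close> is twice the signed area of the triangle, so this is
  Cramer's rule with the denominator cleared: divided by \<open>orient a b c\<close>, the three
  coefficients are the barycentric coordinates of \<open>w\<close>, and \<open>orient_sum\<close>
  says that they add up to one.\<close>

lemma barycentric:
  "orient a b c *\<^sub>R w = orient b c w *\<^sub>R a + orient c a w *\<^sub>R b + orient a b w *\<^sub>R c"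
  by (simp add: vec_eq_iff forall_2 orient_def) algebra

text \<open>A negative orientation is repaired by exchanging the other two vertices, so the
  prescribed vertex \<open>z\<close> can stay in first position; the arguments around a vertex rely
  on this.\<close>

lemma triangle_at_vertex:
  assumes "triangle T" "z \<in> T"
  obtains y c where "T = {z, y, c}" "orient z y c > 0" "z \<noteq> y" "z \<noteq> c" "y \<noteq> c"
proof -
  from assms have "card T = 3" and nc: "\<not> collinear T" by (auto simp: triangle_def)
  then have "card (T - {z}) = 2" using assms by simp
  then obtain y c where yc: "T - {z} = {y, c}" "y \<noteq> c" by (meson card_2_iff)
  then have T: "T = {z, y, c}" and ne: "z \<noteq> y" "z \<noteq> c" using assms by auto
  have "orient z y c \<noteq> 0"
  proof
    assume 0: "orient z y c = 0"
    \<comment> \<open>A vanishing cross product means that \<open>c - z\<close> equals its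
      projection onto \<open>y - z\<close>.\<close>
    have "norm (y - z) ^ 2 *\<^sub>R (c - z) = ((c - z) \<bullet> (y - z)) *\<^sub>R (y - z)"
      using 0 unfolding power2_norm_eq_inner
      by (simp add: vec_eq_iff forall_2 orient_def inner_vec_def sum_2) algebra
    then have "(1 / norm (y - z) ^ 2) *\<^sub>R norm (y - z) ^ 2 *\<^sub>R (c - z)
        = (1 / norm (y - z) ^ 2) *\<^sub>R ((c - z) \<bullet> (y - z)) *\<^sub>R (y - z)"
      by simp
    then have "c - z = (((c - z) \<bullet> (y - z)) / norm (y - z) ^ 2) *\<^sub>R (y - z)"
      using ne by simp
    then have "collinear {0, y - z, c - z}"
      by (metis collinear_lemma)
    then have "collinear {y, z, c}"
      by (cases "y = 0") (auto simp: collinear_3 collinear_def)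
    then show False using nc T by (metis insert_commute)
  qed
  then consider "orient z y c > 0" | "orient z c y > 0"
    using orient_swap[of z c y] orient_rotate[of z c y] orient_rotate[of c y z]
    by (smt (verit) orient_swap orient_rotate)
  then show thesis
    by cases (use that T ne yc in auto)
qed

lemma triangle_oriented:
  assumes "triangle T"
  obtains a b c where "T = {a, b, c}" "orient a b c > 0" "a \<noteq> b" "a \<noteq> c" "b \<noteq> c"
proof -
  have "T \<noteq> {}" using assms by (auto simp: triangle_def)
  then show thesis using triangle_at_vertex[OF assms] that by blast
qed

text \<open>The barycentric coordinates are the three orientations divided by a positive number, so
  their signs decide membership. With strict signs, this description produces open neighbourhoods
  inside a triangle.\<close>

lemma in_triangle_hull_iff:
  assumes "orient a b c > 0"
  shows "w \<in> convex hull {a, b, c} \<longleftrightarrow> orient a b w \<ge> 0 \<and> orient b c w \<ge> 0 \<and> orient c a w \<ge> 0"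
proof
  assume "w \<in> convex hull {a, b, c}"
  then obtain r s t where *: "0 \<le> r" "0 \<le> s" "0 \<le> t" "r + s + t = 1" "w = r *\<^sub>R a + s *\<^sub>R b + t *\<^sub>R c"
    by (auto simp: convex_hull_3)
  show "orient a b w \<ge> 0 \<and> orient b c w \<ge> 0 \<and> orient c a w \<ge> 0"
    using assms * orient_rotate[of a b c] orient_rotate[of c a b] by (simp add: orient_affine)
next
  let ?D = "orient a b c"
  assume *: "orient a b w \<ge> 0 \<and> orient b c w \<ge> 0 \<and> orient c a w \<ge> 0"
  have "w = (1 / ?D) *\<^sub>R (?D *\<^sub>R w)" using assms by simp
  also have "\<dots> = (orient b c w / ?D) *\<^sub>R a + (orient c a w / ?D) *\<^sub>R b + (orient a b w / ?D) *\<^sub>R c"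
    unfolding barycentric[of a b c w] by (simp add: scaleR_add_right)
  finally have w: "w = \<dots>" .
  have "orient b c w / ?D + orient c a w / ?D + orient a b w / ?D = 1"
    using orient_sum[of b c w a] assms by (simp flip: add_divide_distrib)
  then show "w \<in> convex hull {a, b, c}"
    unfolding convex_hull_3 using w * assms by fastforce
qed

lemma measure_triangle:
  "orient a b c > 0 \<Longrightarrow> measure lborel (convex hull {a, b, c}) = orient a b c / 2"
  by (subst content_triangle) (simp add: orient_def algebra_simps abs_if)

lemma compact_triangle: "triangle T \<Longrightarrow> compact (convex hull T)"
  by (rule finite_imp_compact_convex_hull) (auto simp: triangle_def card_ge_0_finite)

text \<open>The affine map permuting the vertices cyclically preserves the triangle, hence the measure, and
  its linear part has no nonzero fixed vector.\<close>
lemma integral_barycentre: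
  assumes D: "orient a b c > 0"
  defines "s \<equiv> (1/3) *\<^sub>R (a + b + c)"
  shows "integral (convex hull {a, b, c}) (\<lambda>x. x - s) = 0"
proof -
  let ?S = "convex hull {a, b, c}"
  define p q r where "p = a - s" and "q = b - s" and "r = c - s"
  have sum0: "p + q + r = 0" unfolding p_def q_def r_def s_def by (simp add: vec_eq_iff forall_2 field_simps)
  define d where "d = p $ 1 * q $ 2 - p $ 2 * q $ 1"
  have r: "r = - p - q" using sum0 by (metis add.inverse_unique diff_conv_add_uminus minus_add_distrib)
  have "orient a b c = 3 * d" unfolding d_def p_def q_def s_def orient_def by (simp add: algebra_simps)
  with D have d0: "d > 0" by simp
  define k where "k = 1 / d"
  have kd: "k * (p $ 1 * q $ 2 - p $ 2 * q $ 1) = 1" using d0 by (simp add: k_def d_def)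
  \<comment> \<open>Coordinates with respect to the basis \<open>p\<close>, \<open>q\<close> by
    Cramer's rule, \<open>k\<close> being the inverse determinant: \<open>G\<close> sends
    \<open>p\<close> to \<open>q\<close>, \<open>q\<close> to \<open>r\<close> and, as the three add
    up to zero, \<open>r\<close> to \<open>p\<close>.\<close>
  define G where "G x = (k * (x $ 1 * q $ 2 - x $ 2 * q $ 1)) *\<^sub>R q + (k * (p $ 1 * x $ 2 - p $ 2 * x $ 1)) *\<^sub>R r" for x :: pt
  have lin: "linear G"
    unfolding G_def by (rule linearI) (simp_all add: vec_eq_iff forall_2 algebra_simps)
  have G1: "G p = q" unfolding G_def using kd by (simp add: mult.commute)
  have G2: "G q = r" unfolding G_def using kd by (simp add: mult.commute)
  have G3: "G r = p" unfolding r linear_diff[OF lin] linear_neg[OF lin] G1 G2 by simp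
  let ?g = "\<lambda>x. s + G (x - s)"
  have img: "?g ` ?S = ?S"
  proof -
    have "?g ` ?S = (+) s ` G ` (+) (- s) ` ?S" by (simp add: image_image)
    also have "\<dots> = convex hull ((+) s ` G ` (+) (- s) ` {a, b, c})"
      by (simp only: convex_hull_translation[symmetric] convex_hull_linear_image[OF lin])
    also have "(+) s ` G ` (+) (- s) ` {a, b, c} = {a, b, c}"
      using G1 G2 G3 by (auto simp: p_def q_def r_def)
    finally show ?thesis .
  qed
  have meas: "?S \<in> lmeasurable"
    by (intro lmeasurable_compact finite_imp_compact_convex_hull) auto
  have pos: "measure lebesgue ?S > 0"
    using measure_triangle[OF D] D
    by (simp add: compact_imp_closed[THEN borel_closed] finite_imp_compact_convex_hull)
  have der: "(?g has_derivative G) (at x within ?S)" for x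
  proof -
    have "((\<lambda>x. (s - G s) + G x) has_derivative (\<lambda>x. 0 + G x)) (at x within ?S)"
      using lin by (intro has_derivative_add has_derivative_const bounded_linear_imp_has_derivative)
        (simp add: linear_linear)
    then show ?thesis using lin by (simp add: linear_diff algebra_simps)
  qed
  have inj: "inj ?g"
  proof -
    \<comment> \<open>The third power of \<open>G\<close> is the identity, since it fixes the basis
      \<open>p\<close>, \<open>q\<close>.\<close>
    have "G x = 0 \<Longrightarrow> x = 0" for x
    proof -
      assume "G x = 0"
      then have "G (G (G x)) = 0" using lin by (simp add: linear_0)
      moreover have x: "x = (k * (x $ 1 * q $ 2 - x $ 2 * q $ 1)) *\<^sub>R p + (k * (p $ 1 * x $ 2 - p $ 2 * x $ 1)) *\<^sub>R q"
        using kd by (simp add: vec_eq_iff forall_2) algebra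
      have "G (G (G x)) = x"
        by (subst x, simp add: linear_add[OF lin] linear_scale[OF lin] G1 G2 G3) (use x in simp)
      ultimately show "x = 0" by simp
    qed
    then have "inj G" using lin by (simp add: linear_injective_0)
    then show ?thesis by (intro injI) (metis add_left_cancel diff_add_cancel injD)
  qed
  have "measure lebesgue (?g ` ?S) = \<bar>det (matrix G)\<bar> * measure lebesgue ?S"
  proof -
    have "measure lebesgue (?g ` ?S) = measure lebesgue ((+) s ` G ` (+) (- s) ` ?S)"
      by (simp add: image_image)
    also have "\<dots> = \<bar>det (matrix G)\<bar> * measure lebesgue ?S"
      by (simp only: measure_translation measure_linear_image[OF lin measurable_translation[OF meas]])
    finally show ?thesis .
  qed
  \<comment> \<open>The map carries the triangle onto itself and the area is positive, so the
    determinant need not be computed.\<close>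
  then have det: "\<bar>det (matrix G)\<bar> = 1" using img pos by simp
  have int: "(\<lambda>x. x - s) absolutely_integrable_on ?S"
    unfolding set_integrable_def
    by (intro integrable_completion[THEN iffD2] borel_integrable_compact borel_measurable_integrable
        finite_imp_compact_convex_hull continuous_intros) auto
  define M where "M = integral ?S (\<lambda>x. x - s)"
  have "M = integral (?g ` ?S) (\<lambda>x. x - s)" unfolding M_def img ..
  also have "\<dots> = integral ?S (\<lambda>x. \<bar>det (matrix G)\<bar> *\<^sub>R (?g x - s))"
    by (rule integral_change_of_variables) (use meas der inj int img in \<open>auto intro: inj_on_subset\<close>)
  also have "\<dots> = integral ?S (G \<circ> (\<lambda>x. x - s))" using det by (simp add: o_def)
  also have "\<dots> = G M"
    unfolding M_def using int lin by (intro integral_linear) (auto simp: absolutely_integrable_on_def linear_linear)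
  finally have "M = G M" .
  define u v where "u = k * (M $ 1 * q $ 2 - M $ 2 * q $ 1)" and "v = k * (p $ 1 * M $ 2 - p $ 2 * M $ 1)"
  have M: "M = u *\<^sub>R p + v *\<^sub>R q"
    unfolding u_def v_def using kd by (simp add: vec_eq_iff forall_2) algebra
  have "G M = u *\<^sub>R q + v *\<^sub>R r"
    by (subst M) (simp add: linear_add[OF lin] linear_scale[OF lin] G1 G2)
  then have "u *\<^sub>R p + v *\<^sub>R q = u *\<^sub>R q + v *\<^sub>R r"
    using \<open>M = G M\<close> M by simp
  \<comment> \<open>Comparing both expansions of \<open>M\<close> gives (u + v) p = (u - 2 v) q;
    independence of \<open>p\<close> and \<open>q\<close> then forces u = v = 0.\<close>
  then have e: "(u + v) * p $ 1 = (u - 2 * v) * q $ 1" "(u + v) * p $ 2 = (u - 2 * v) * q $ 2"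
    unfolding r by (simp_all add: vec_eq_iff forall_2 algebra_simps)
  have "(u + v) * d = 0" "(u - 2 * v) * d = 0"
    unfolding d_def using e by algebra+
  then have "u = 0" "v = 0" using d0 by auto
  then show ?thesis using M by (simp add: M_def)
qed

text \<open>One-point quadrature: after splitting off the value at the centroid, the remainder is
  linear around the centroid and integrates to zero by \<open>integral_barycentre\<close>.\<close>

lemma integral_affine_triangle:
  assumes D: "orient a b c > 0"
  shows "integral (convex hull {a, b, c}) (\<lambda>x. g \<bullet> x + k) = orient a b c / 2 * (g \<bullet> ((1/3) *\<^sub>R (a + b + c)) + k)"
proof -
  let ?S = "convex hull {a, b, c}"
  let ?s = "(1/3) *\<^sub>R (a + b + c)"
  have co: "compact ?S" by (simp add: finite_imp_compact_convex_hull)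
  have intg: "f integrable_on ?S" if "continuous_on ?S f" for f :: "pt \<Rightarrow> 'a :: euclidean_space"
    using set_borel_integral_eq_integral(1) borel_integrable_compact[OF co that]
    unfolding set_integrable_def by blast
  have "integral ?S (\<lambda>x. g \<bullet> x + k) = integral ?S (\<lambda>x. g \<bullet> (x - ?s) + (g \<bullet> ?s + k))"
    by (simp add: inner_diff_right)
  also have "\<dots> = integral ?S (\<lambda>x. g \<bullet> (x - ?s)) + integral ?S (\<lambda>x. g \<bullet> ?s + k)"
    by (intro Henstock_Kurzweil_Integration.integral_add intg continuous_intros)
  also have "integral ?S (\<lambda>x. g \<bullet> (x - ?s)) = g \<bullet> integral ?S (\<lambda>x. x - ?s)"
    using integral_linear[of "\<lambda>x. x - ?s" ?S "\<lambda>x. g \<bullet> x"]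
    by (simp add: o_def intg continuous_intros bounded_linear_inner_right)
  also have "\<dots> = 0" using integral_barycentre[OF D] by simp
  also have "integral ?S (\<lambda>x. g \<bullet> ?s + k) = measure lebesgue ?S * (g \<bullet> ?s + k)"
    using lmeasurable_compact[OF co] by (simp add: lmeasure_integral integral_mult_left[symmetric])
  also have "measure lebesgue ?S = orient a b c / 2"
    using measure_triangle[OF D] co by (simp add: compact_imp_closed[THEN borel_closed])
  finally show ?thesis by simp
qed

section \<open>Integration over elements and edges\<close>

definition area :: "pt set \<Rightarrow> real" where
  "area T = measure lborel (convex hull T)"

lemma set_integrable_triangle:
  assumes "triangle T" "continuous_on (convex hull T) f"
  shows "set_integrable lborel (convex hull T) (f :: pt \<Rightarrow> real)"
  using borel_integrable_compact[OF compact_triangle[OF assms(1)] assms(2)] by (simp add: set_integrable_def)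

lemma elem_int_add:
  assumes "triangle T" "continuous_on (convex hull T) f" "continuous_on (convex hull T) g"
  shows "elem_int T (\<lambda>x. f x + g x) = elem_int T f + elem_int T g"
  unfolding elem_int_def using set_integrable_triangle assms by (intro set_integral_add) auto

lemma elem_int_cmult: "elem_int T (\<lambda>x. c * f x) = c * elem_int T f"
  unfolding elem_int_def by simp

lemma elem_int_mono:
  assumes "triangle T" "continuous_on (convex hull T) f" "continuous_on (convex hull T) g"
    "\<And>x. x \<in> convex hull T \<Longrightarrow> f x \<le> g x"
  shows "elem_int T f \<le> elem_int T g"
  unfolding elem_int_def using set_integrable_triangle assms by (intro set_integral_mono) auto

lemma elem_int_nonneg:
  assumes "\<And>x. x \<in> convex hull T \<Longrightarrow> 0 \<le> f x"
  shows "0 \<le> elem_int T f"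
  unfolding elem_int_def set_lebesgue_integral_def
  by (intro Bochner_Integration.integral_nonneg) (use assms in \<open>auto simp: indicator_def\<close>)

lemma elem_int_eq_integral:
  assumes "triangle T" "continuous_on (convex hull T) f"
  shows "elem_int T f = integral (convex hull T) f"
  unfolding elem_int_def by (intro set_borel_integral_eq_integral set_integrable_triangle assms)

lemma triangle_orient: "orient a b c > 0 \<Longrightarrow> triangle {a, b, c}"
proof -
  assume D: "orient a b c > 0"
  then have ne: "a \<noteq> b" "b \<noteq> c" "a \<noteq> c" by (auto simp: orient_def)
  have "\<not> collinear {a, b, c}"
  proof
    assume "collinear {a, b, c}"
    then obtain u where b: "b = u *\<^sub>R a + (1 - u) *\<^sub>R c" using ne by (auto simp: collinear_3_expand)
    have "orient a b c = 0" unfolding b by (simp add: orient_def algebra_simps)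
    with D show False by simp
  qed
  then show ?thesis using ne by (simp add: triangle_def)
qed

lemma elem_int_affine:
  assumes "orient a b c > 0"
  shows "elem_int {a, b, c} (\<lambda>x. g \<bullet> x + k) = area {a, b, c} * (g \<bullet> ((1/3) *\<^sub>R (a + b + c)) + k)"
  unfolding area_def measure_triangle[OF assms] integral_affine_triangle[OF assms, symmetric]
  by (simp add: elem_int_eq_integral[OF triangle_orient[OF assms]] continuous_intros)

lemma elem_int_const: "triangle T \<Longrightarrow> elem_int T (\<lambda>x. k) = area T * k"
  using elem_int_affine[of _ _ _ 0 k] by (elim triangle_oriented) simp

text \<open>\<open>edge_pts\<close> picks the order of the endpoints by \<open>SOME\<close>; the
  substitution of 1 - t for t shows that the choice does not affect the integral.\<close>

lemma edge_int_eq: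
  assumes "a \<noteq> b"
  shows "edge_int {a, b} f = dist a b * (LINT t : {0..1} | lborel. f ((1 - t) *\<^sub>R a + t *\<^sub>R b))"
proof -
  let ?P = "\<lambda>p. {a, b} = {fst p, snd p} \<and> fst p \<noteq> snd p"
  have "?P (edge_pts {a, b})" unfolding edge_pts_def by (rule someI[of ?P "(a, b)"]) (use assms in auto)
  then consider "edge_pts {a, b} = (a, b)" | "edge_pts {a, b} = (b, a)"
    by (metis doubleton_eq_iff prod.collapse)
  then show ?thesis
  proof cases
    case 1 then show ?thesis by (simp add: edge_int_def)
  next
    case 2
    have "(LINT t : {0..1} | lborel. f ((1 - t) *\<^sub>R b + t *\<^sub>R a)) = (LINT t : {0..1} | lborel. f ((1 - t) *\<^sub>R a + t *\<^sub>R b))"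
      unfolding set_lebesgue_integral_def
      by (subst lborel_integral_real_affine[of "-1" _ 1])
        (auto simp: indicator_def add.commute intro!: Bochner_Integration.integral_cong)
    with 2 show ?thesis by (simp add: edge_int_def dist_commute)
  qed
qed

lemma edge_param_in_hull: "t \<in> {0..1} \<Longrightarrow> (1 - t) *\<^sub>R a + t *\<^sub>R b \<in> convex hull {a, b :: pt}"
  unfolding segment_convex_hull[symmetric] closed_segment_def by auto

lemma edge_int_cong:
  assumes "card e = 2" "\<And>x. x \<in> convex hull e \<Longrightarrow> f x = g x"
  shows "edge_int e f = edge_int e g"
proof -
  obtain a b where e: "e = {a, b}" "a \<noteq> b" using assms(1) by (auto simp: card_2_iff)
  show ?thesis unfolding e(1) edge_int_eq[OF e(2)]
    by (intro arg_cong2[where f="(*)"] refl set_lebesgue_integral_cong)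
      (use edge_param_in_hull assms(2) e in auto)
qed

lemma set_integrable_edge:
  assumes "continuous_on (convex hull {a, b}) (f :: pt \<Rightarrow> real)"
  shows "set_integrable lborel {0..1} (\<lambda>t. f ((1 - t) *\<^sub>R a + t *\<^sub>R b))"
proof -
  have "continuous_on {0..1} (\<lambda>t. f ((1 - t) *\<^sub>R a + t *\<^sub>R b))"
    by (rule continuous_on_compose2[OF assms]) (auto intro!: continuous_intros edge_param_in_hull)
  then show ?thesis unfolding set_integrable_def by (intro borel_integrable_compact) auto
qed

lemma edge_int_add:
  assumes "card e = 2" "continuous_on (convex hull e) f" "continuous_on (convex hull e) g"
  shows "edge_int e (\<lambda>x. f x + g x) = edge_int e f + edge_int e g"
proof -
  obtain a b where e: "e = {a, b}" "a \<noteq> b" using assms(1) by (auto simp: card_2_iff)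
  show ?thesis using set_integrable_edge assms unfolding e(1) edge_int_eq[OF e(2)]
    by (simp add: distrib_left)
qed

lemma edge_int_cmult: "edge_int e (\<lambda>x. k * f x) = k * edge_int e f"
  by (simp add: edge_int_def split: prod.split)

lemma edge_int_mono:
  assumes "card e = 2" "continuous_on (convex hull e) f" "continuous_on (convex hull e) g"
    "\<And>x. x \<in> convex hull e \<Longrightarrow> f x \<le> g x"
  shows "edge_int e f \<le> edge_int e g"
proof -
  obtain a b where e: "e = {a, b}" "a \<noteq> b" using assms(1) by (auto simp: card_2_iff)
  show ?thesis unfolding e(1) edge_int_eq[OF e(2)]
    using assms e set_integrable_edge edge_param_in_hull
    by (intro mult_left_mono set_integral_mono) auto
qed

lemma edge_int_const: "a \<noteq> b \<Longrightarrow> edge_int {a, b} (\<lambda>x. k) = dist a b * k"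
  by (simp add: edge_int_eq set_integral_const)

text \<open>This is the mass matrix of linear elements on an edge. The factors are assumed linear
  only along the edge, because an edge trace is known nowhere else.\<close>

lemma edge_int_affine_mult:
  assumes "a \<noteq> b"
    and f: "\<And>t. t \<in> {0..1} \<Longrightarrow> f ((1 - t) *\<^sub>R a + t *\<^sub>R b) = (1 - t) * p + t * q"
    and g: "\<And>t. t \<in> {0..1} \<Longrightarrow> g ((1 - t) *\<^sub>R a + t *\<^sub>R b) = (1 - t) * r + t * s"
  shows "edge_int {a, b} (\<lambda>x. f x * g x) = dist a b * ((2 * p * r + p * s + q * r + 2 * q * s) / 6)"
proof -
  let ?h = "\<lambda>t :: real. ((1 - t) * p + t * q) * ((1 - t) * r + t * s)"
  let ?H = "\<lambda>t :: real. p * r * t + (p * (s - r) + r * (q - p)) * t^2 / 2 + (q - p) * (s - r) * t^3 / 3"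
  have "(LINT t : {0..1} | lborel. f ((1 - t) *\<^sub>R a + t *\<^sub>R b) * g ((1 - t) *\<^sub>R a + t *\<^sub>R b)) = (LINT t : {0..1} | lborel. ?h t)"
    by (intro set_lebesgue_integral_cong) (use f g in auto)
  also have "\<dots> = integral {0..1} ?h"
    by (intro set_borel_integral_eq_integral, unfold set_integrable_def, intro borel_integrable_compact continuous_intros) auto
  also have "(?h has_integral (?H 1 - ?H 0)) {0..1}"
    by (rule fundamental_theorem_of_calculus,
        auto simp flip: has_real_derivative_iff_has_vector_derivative intro!: derivative_eq_intros)
      (simp add: field_simps power2_eq_square)
  then have "integral {0..1} ?h = ?H 1 - ?H 0" by (rule integral_unique)
  also have "\<dots> = (2 * p * r + p * s + q * r + 2 * q * s) / 6" by (simp add: field_simps)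
  finally show ?thesis by (simp add: edge_int_eq[OF assms(1)])
qed

section \<open>The local solver\<close>

lemma tri_edges_eq:
  assumes "a \<noteq> b" "a \<noteq> c" "b \<noteq> c"
  shows "tri_edges {a, b, c} = {{a, b}, {b, c}, {c, a}}"
proof -
  have "e \<in> {{a, b}, {b, c}, {c, a}}" if "e \<subseteq> {a, b, c}" "card e = 2" for e
  proof -
    obtain x y where "e = {x, y}" "x \<noteq> y" using \<open>card e = 2\<close> by (auto simp: card_2_iff)
    then show ?thesis using that by auto
  qed
  then show ?thesis using assms by (auto simp: tri_edges_def)
qed

lemma orient_pos_distinct: "orient a b c > 0 \<Longrightarrow> a \<noteq> b \<and> a \<noteq> c \<and> b \<noteq> c"
  by (auto simp: orient_def)

lemma bdry_int_eq:
  assumes "orient a b c > 0"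
  shows "bdry_int {a, b, c} g = edge_int {a, b} (g {a, b}) + edge_int {b, c} (g {b, c}) + edge_int {c, a} (g {c, a})"
proof -
  have "a \<noteq> b" "a \<noteq> c" "b \<noteq> c" using orient_pos_distinct[OF assms] by auto
  then have "{a, b} \<noteq> {b, c}" "{a, b} \<noteq> {c, a}" "{b, c} \<noteq> {c, a}" by (auto simp: doubleton_eq_iff)
  then show ?thesis
    unfolding bdry_int_def using \<open>a \<noteq> b\<close> \<open>a \<noteq> c\<close> \<open>b \<noteq> c\<close> by (simp add: tri_edges_eq)
qed

lemma finite_tri_edges: "triangle T \<Longrightarrow> finite (tri_edges T)"
  by (rule finite_subset[of _ "Pow T"]) (auto simp: tri_edges_def triangle_def card_ge_0_finite)

lemma card_tri_edge: "e \<in> tri_edges T \<Longrightarrow> card e = 2"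
  by (simp add: tri_edges_def)

lemma bdry_int_add:
  assumes "\<And>e. e \<in> tri_edges T \<Longrightarrow> continuous_on (convex hull e) (f e)"
    "\<And>e. e \<in> tri_edges T \<Longrightarrow> continuous_on (convex hull e) (g e)"
  shows "bdry_int T (\<lambda>e x. f e x + g e x) = bdry_int T f + bdry_int T g"
  unfolding bdry_int_def sum.distrib[symmetric]
  by (intro sum.cong refl edge_int_add) (use assms card_tri_edge in auto)

lemma bdry_int_cmult: "bdry_int T (\<lambda>e x. k * f e x) = k * bdry_int T f"
  by (simp add: bdry_int_def edge_int_cmult sum_distrib_left)

lemma bdry_int_mono:
  assumes "\<And>e. e \<in> tri_edges T \<Longrightarrow> continuous_on (convex hull e) (f e)"
    "\<And>e. e \<in> tri_edges T \<Longrightarrow> continuous_on (convex hull e) (g e)"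
    "\<And>e x. e \<in> tri_edges T \<Longrightarrow> x \<in> convex hull e \<Longrightarrow> f e x \<le> g e x"
  shows "bdry_int T f \<le> bdry_int T g"
  unfolding bdry_int_def by (intro sum_mono edge_int_mono) (use assms card_tri_edge in auto)

lemma bdry_int_cong:
  assumes "\<And>e x. e \<in> tri_edges T \<Longrightarrow> x \<in> convex hull e \<Longrightarrow> f e x = g e x"
  shows "bdry_int T f = bdry_int T g"
  unfolding bdry_int_def by (intro sum.cong refl edge_int_cong) (use assms card_tri_edge in auto)

section \<open>Outer normals and the divergence theorem on a triangle\<close>

lemma rot90_inner: "rot90 u \<bullet> v = u $ 1 * v $ 2 - u $ 2 * v $ 1"
  by (simp add: rot90_def inner_vec_def sum_2)

lemma norm_rot90 [simp]: "norm (rot90 u) = norm u"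
  by (simp add: rot90_def norm_vec_def L2_set_def sum_2 add.commute)

text \<open>Positive orientation puts the third vertex to the left of the direction from
  \<open>a\<close> to \<open>b\<close>, hence the minus sign, whichever order
  \<open>edge_pts\<close> has chosen. The other two edges follow by rotating the names of the
  vertices.\<close>

lemma outer_normal_eq:
  assumes "orient a b c > 0"
  shows "outer_normal {a, b, c} {a, b} = (- 1 / dist a b) *\<^sub>R rot90 (b - a)"
proof -
  have ne: "a \<noteq> b" "a \<noteq> c" "b \<noteq> c" using orient_pos_distinct[OF assms] by auto
  let ?P = "\<lambda>p. {a, b} = {fst p, snd p} \<and> fst p \<noteq> snd p"
  have "?P (edge_pts {a, b})" unfolding edge_pts_def by (rule someI[of ?P "(a, b)"]) (use ne in auto)
  then consider "edge_pts {a, b} = (a, b)" | "edge_pts {a, b} = (b, a)"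
    by (metis doubleton_eq_iff prod.collapse)
  moreover have c: "(THE x. x \<in> {a, b, c} - {a, b}) = c" by (rule the_equality) (use ne in auto)
  moreover have "rot90 (b - a) \<bullet> (c - a) = orient a b c"
    "rot90 (a - b) \<bullet> (c - b) = - orient a b c"
    by (simp_all add: rot90_inner orient_def algebra_simps)
  moreover have "rot90 (a - b) = - rot90 (b - a)"
    by (simp add: rot90_def vec_eq_iff forall_2)
  ultimately show ?thesis
    using assms by cases (simp_all add: outer_normal_def Let_def dist_norm norm_minus_commute)
qed

lemma P1_param:
  assumes "w \<in> P1" obtains g k where "w = (\<lambda>x. g \<bullet> x + k)"
  using assms unfolding P1_def by auto

lemma P1vec_param:
  assumes "v \<in> P1vec" obtains A k where "v = (\<lambda>x. A *v x + k)"
  using assms unfolding P1vec_def by auto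

lemma P1I: "(\<lambda>x. g \<bullet> x + k) \<in> P1"
  unfolding P1_def by auto

lemma P1vecI: "(\<lambda>x. A *v x + k) \<in> P1vec"
  unfolding P1vec_def by auto

lemma grad_affine: "grad (\<lambda>x. g \<bullet> x + k) x = g"
proof -
  have "((\<lambda>x. g \<bullet> x + k) has_derivative (\<lambda>h. g \<bullet> h)) (at x)"
    by (auto intro!: derivative_eq_intros)
  then have "frechet_derivative (\<lambda>x. g \<bullet> x + k) (at x) = (\<lambda>h. g \<bullet> h)"
    by (rule frechet_derivative_at[symmetric])
  then show ?thesis by (simp add: grad_def vec_eq_iff inner_axis)
qed

lemma vdiv_affine: "vdiv (\<lambda>x. A *v x + k) x = trace A"
proof -
  have "((\<lambda>x. A *v x + k) has_derivative (\<lambda>h. A *v h)) (at x)"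
    by (auto intro!: derivative_eq_intros bounded_linear_imp_has_derivative simp: matrix_vector_mul_bounded_linear)
  then have "frechet_derivative (\<lambda>x. A *v x + k) (at x) = (\<lambda>h. A *v h)"
    by (rule frechet_derivative_at[symmetric])
  then show ?thesis by (simp add: vdiv_def trace_def matrix_vector_mult_basis column_def)
qed

lemma affine_on_segment:
  fixes g :: pt
  shows "g \<bullet> ((1 - t) *\<^sub>R a + t *\<^sub>R b) + k = (1 - t) * (g \<bullet> a + k) + t * (g \<bullet> b + k)"
  by (simp add: algebra_simps)

text \<open>Both factors are linear along the edge, so the mass matrix is exact; the edge length
  cancels against the normalization of the normal and leaves a polynomial in the vertex
  coordinates.\<close>

lemma edge_flux:
  fixes A :: "real^2^2" and g u :: pt and k :: real
  assumes D: "orient a b c > 0"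
  defines "v \<equiv> \<lambda>x. A *v x + u" and "w \<equiv> \<lambda>x. g \<bullet> x + k"
  shows "edge_int {a, b} (\<lambda>x. w x * (v x \<bullet> outer_normal {a, b, c} {a, b})) =
    - (2 * w a * (v a \<bullet> rot90 (b - a)) + w a * (v b \<bullet> rot90 (b - a))
     + w b * (v a \<bullet> rot90 (b - a)) + 2 * w b * (v b \<bullet> rot90 (b - a))) / 6"
proof -
  have ne: "a \<noteq> b" using orient_pos_distinct[OF D] by auto
  have v: "v ((1 - t) *\<^sub>R a + t *\<^sub>R b) = (1 - t) *\<^sub>R v a + t *\<^sub>R v b" for t
    unfolding v_def by (simp add: matrix_vector_right_distrib matrix_vector_mult_scaleR algebra_simps)
  let ?n = "outer_normal {a, b, c} {a, b}"
  have "edge_int {a, b} (\<lambda>x. w x * (v x \<bullet> ?n)) = dist a b *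
    ((2 * w a * (v a \<bullet> ?n) + w a * (v b \<bullet> ?n) + w b * (v a \<bullet> ?n) + 2 * w b * (v b \<bullet> ?n)) / 6)"
    by (rule edge_int_affine_mult[OF ne])
      (simp_all only: v w_def affine_on_segment inner_add_left inner_scaleR_left)
  also have "\<dots> = - (2 * w a * (v a \<bullet> rot90 (b - a)) + w a * (v b \<bullet> rot90 (b - a))
     + w b * (v a \<bullet> rot90 (b - a)) + 2 * w b * (v b \<bullet> rot90 (b - a))) / 6"
    using ne unfolding outer_normal_eq[OF D] by (simp add: field_simps)
  finally show ?thesis .
qed

text \<open>This is Gauss's theorem for the product of an affine function and an affine field. The
  centroid rule and \<open>edge_flux\<close>, applied to the three rotations of the triangle, turn
  it into an identity of polynomials in the vertex coordinates.\<close>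

lemma divergence_theorem_triangle:
  fixes A :: "real^2^2" and g :: pt
  assumes "triangle T"
  shows "elem_int T (\<lambda>x. (A *v x + u) \<bullet> g) + elem_int T (\<lambda>x. (g \<bullet> x + k) * trace A)
    = bdry_int T (\<lambda>e x. (g \<bullet> x + k) * ((A *v x + u) \<bullet> outer_normal T e))"
proof -
  obtain a b c where T: "T = {a, b, c}" and D: "orient a b c > 0"
    using triangle_oriented[OF assms] by metis
  have D2: "orient b c a > 0" "orient c a b > 0" using D by (simp_all add: orient_rotate[of b c a] orient_rotate[of c a b])
  have T2: "T = {b, c, a}" "T = {c, a, b}" using T by auto
  have ar: "area T = orient a b c / 2" using measure_triangle[OF D] by (simp add: area_def T)
  have "elem_int T (\<lambda>x. (A *v x + u) \<bullet> g) = elem_int T (\<lambda>x. (transpose A *v g) \<bullet> x + u \<bullet> g)"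
    by (intro arg_cong[where f = "elem_int T"] ext)
      (simp add: inner_vec_def sum_2 matrix_vector_mult_def transpose_def algebra_simps)
  also have "\<dots> = area T * ((transpose A *v g) \<bullet> ((1/3) *\<^sub>R (a + b + c)) + u \<bullet> g)"
    unfolding T by (rule elem_int_affine[OF D])
  finally have 1: "elem_int T (\<lambda>x. (A *v x + u) \<bullet> g) = \<dots>" .
  have 2: "elem_int T (\<lambda>x. (g \<bullet> x + k) * trace A) = trace A * (area T * (g \<bullet> ((1/3) *\<^sub>R (a + b + c)) + k))"
    using elem_int_cmult[of T "trace A" "\<lambda>x. g \<bullet> x + k"] elem_int_affine[OF D] by (simp add: T mult.commute)
  have 3: "bdry_int T (\<lambda>e x. (g \<bullet> x + k) * ((A *v x + u) \<bullet> outer_normal T e)) =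
      edge_int {a, b} (\<lambda>x. (g \<bullet> x + k) * ((A *v x + u) \<bullet> outer_normal {a, b, c} {a, b})) +
      edge_int {b, c} (\<lambda>x. (g \<bullet> x + k) * ((A *v x + u) \<bullet> outer_normal {b, c, a} {b, c})) +
      edge_int {c, a} (\<lambda>x. (g \<bullet> x + k) * ((A *v x + u) \<bullet> outer_normal {c, a, b} {c, a}))"
    unfolding T2[symmetric] T[symmetric] by (simp add: T bdry_int_eq[OF D])
  show ?thesis
    unfolding 1 2 3 edge_flux[OF D] edge_flux[OF D2(1)] edge_flux[OF D2(2)] ar orient_def
    by (simp add: inner_vec_def sum_2 matrix_vector_mult_def trace_def transpose_def rot90_def field_simps)
qed

text \<open>A finite-dimensional Lax-Milgram argument, without symmetry of \<open>S\<close>: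
  \<open>\<Phi> p\<close> represents the functional \<open>S p\<close>, definiteness makes the
  linear map \<open>\<Phi>\<close> injective, hence surjective.\<close>

lemma finite_dim_solvable:
  fixes S :: "'a::euclidean_space \<Rightarrow> 'a \<Rightarrow> real"
  assumes S: "bilinear S" and F: "linear F" and definite: "\<And>p. S p p = 0 \<Longrightarrow> p = 0"
  shows "\<exists>!p. \<forall>q. S p q = F q"
proof -
  have lin1: "linear (\<lambda>p. S p q)" and lin2: "linear (S p)" for p q
    using S by (auto simp: bilinear_def)
  define \<Phi> where "\<Phi> p = (\<Sum>i\<in>Basis. S p i *\<^sub>R i)" for p
  have rep: "(\<Sum>i\<in>Basis. f i *\<^sub>R i) \<bullet> q = f q" if "linear f" for f :: "'a \<Rightarrow> real" and q
  proof -
    have "f q = f (\<Sum>i\<in>Basis. (q \<bullet> i) *\<^sub>R i)" by (simp add: euclidean_representation)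
    also have "\<dots> = (\<Sum>i\<in>Basis. (q \<bullet> i) * f i)"
      using that by (simp add: linear_sum linear_scale)
    finally show ?thesis by (simp add: inner_sum_left inner_commute[of q] mult.commute)
  qed
  have "linear \<Phi>"
    unfolding \<Phi>_def using lin1
    by (intro linear_compose_sum ballI) (auto simp: linear_iff scaleR_add_left)
  moreover have "inj \<Phi>"
    unfolding linear_injective_0[OF \<open>linear \<Phi>\<close>]
    using rep[OF lin2] definite unfolding \<Phi>_def by (metis inner_zero_left)
  ultimately have "surj \<Phi>" by (metis linear_injective_imp_surjective)
  then obtain p where p: "\<Phi> p = (\<Sum>i\<in>Basis. F i *\<^sub>R i)" by (metis surjD)
  then have "\<forall>q. S p q = F q" using rep[OF lin2] rep[OF F] by (metis \<Phi>_def)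
  moreover have "p' = p" if "\<forall>q. S p' q = F q" for p'
  proof -
    have "S (p' - p) (p' - p) = 0"
      using that \<open>\<forall>q. S p q = F q\<close> linear_diff[OF lin1] by simp
    then show ?thesis using definite by force
  qed
  ultimately show ?thesis by blast
qed

text \<open>Coefficients of a pair (Q, U): matrix and constant of Q, then gradient and constant of
  U. The product is a Euclidean space, so \<open>finite_dim_solvable\<close> applies to it.\<close>

type_synonym params = "(real^2^2) \<times> (real^2) \<times> (real^2) \<times> real"

definition Qfun :: "params \<Rightarrow> pt \<Rightarrow> pt" where
  "Qfun p x = fst p *v x + fst (snd p)"

definition Ufun :: "params \<Rightarrow> pt \<Rightarrow> real" where
  "Ufun p x = fst (snd (snd p)) \<bullet> x + snd (snd (snd p))"

text \<open>The sum of the two local equations with the data moved to \<open>solver_rhs\<close>. For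
  the test pair encoded by \<open>q\<close>, \<open>trace (fst q)\<close> is the divergence of the
  field and \<open>fst (snd (snd q))\<close> the gradient of the scalar function.\<close>

definition solver_form :: "real \<Rightarrow> pt set \<Rightarrow> params \<Rightarrow> params \<Rightarrow> real" where
  "solver_form \<tau> T p q = elem_int T (\<lambda>x. Qfun p x \<bullet> Qfun q x) - elem_int T (\<lambda>x. Ufun p x * trace (fst q))
     - elem_int T (\<lambda>x. Qfun p x \<bullet> fst (snd (snd q)))
     + bdry_int T (\<lambda>e x. (Qfun p x \<bullet> outer_normal T e + \<tau> * Ufun p x) * Ufun q x)"

definition solver_rhs :: "real \<Rightarrow> pt set \<Rightarrow> (pt set \<Rightarrow> pt \<Rightarrow> real) \<Rightarrow> params \<Rightarrow> real" where
  "solver_rhs \<tau> T m q = - bdry_int T (\<lambda>e x. m e x * (Qfun q x \<bullet> outer_normal T e))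
     + \<tau> * bdry_int T (\<lambda>e x. m e x * Ufun q x)"

lemma continuous_on_Qfun [continuous_intros]: "continuous_on S (Qfun p)"
  unfolding Qfun_def[abs_def] by (intro continuous_intros linear_continuous_on matrix_vector_mul_bounded_linear)

lemma continuous_on_Ufun [continuous_intros]: "continuous_on S (Ufun p)"
  unfolding Ufun_def[abs_def] by (intro continuous_intros)

lemma Qfun_add: "Qfun (p + q) x = Qfun p x + Qfun q x"
  by (simp add: Qfun_def matrix_vector_mult_add_rdistrib algebra_simps)

lemma Qfun_scale: "Qfun (k *\<^sub>R p) x = k *\<^sub>R Qfun p x"
  by (simp add: Qfun_def scaleR_matrix_vector_assoc scaleR_add_right)

lemma Ufun_add: "Ufun (p + q) x = Ufun p x + Ufun q x"
  by (simp add: Ufun_def algebra_simps)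

lemma Ufun_scale: "Ufun (k *\<^sub>R p) x = k * Ufun p x"
  by (simp add: Ufun_def algebra_simps)

lemma trace_scaleR: "trace (k *\<^sub>R A) = k * trace (A :: real^'n^'n)"
  by (simp add: trace_def sum_distrib_left)

lemma bilinear_solver_form:
  assumes T: "triangle T"
  shows "bilinear (solver_form \<tau> T)"
  unfolding bilinear_def
proof (intro conjI allI)
  fix p
  show "linear (solver_form \<tau> T p)"
  proof (rule linearI)
    fix q r
    have 1: "elem_int T (\<lambda>x. Qfun p x \<bullet> Qfun q x + Qfun p x \<bullet> Qfun r x)
      = elem_int T (\<lambda>x. Qfun p x \<bullet> Qfun q x) + elem_int T (\<lambda>x. Qfun p x \<bullet> Qfun r x)"
      by (intro elem_int_add T continuous_intros)
    have 2: "elem_int T (\<lambda>x. Ufun p x * trace (fst q) + Ufun p x * trace (fst r))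
      = elem_int T (\<lambda>x. Ufun p x * trace (fst q)) + elem_int T (\<lambda>x. Ufun p x * trace (fst r))"
      by (intro elem_int_add T continuous_intros)
    have 3: "elem_int T (\<lambda>x. Qfun p x \<bullet> fst (snd (snd q)) + Qfun p x \<bullet> fst (snd (snd r)))
      = elem_int T (\<lambda>x. Qfun p x \<bullet> fst (snd (snd q))) + elem_int T (\<lambda>x. Qfun p x \<bullet> fst (snd (snd r)))"
      by (intro elem_int_add T continuous_intros)
    let ?b = "\<lambda>q e x. (Qfun p x \<bullet> outer_normal T e + \<tau> * Ufun p x) * Ufun q x"
    have 4: "bdry_int T (\<lambda>e x. ?b q e x + ?b r e x) = bdry_int T (?b q) + bdry_int T (?b r)"
      by (intro bdry_int_add continuous_intros)
    show "solver_form \<tau> T p (q + r) = solver_form \<tau> T p q + solver_form \<tau> T p r"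
      using 1 2 3 4 by (simp add: solver_form_def Qfun_add Ufun_add trace_add inner_add_right distrib_left)
  next
    fix q and k :: real
    let ?b = "\<lambda>q e x. (Qfun p x \<bullet> outer_normal T e + \<tau> * Ufun p x) * Ufun q x"
    have "bdry_int T (?b (k *\<^sub>R q)) = k * bdry_int T (?b q)"
      unfolding bdry_int_cmult[symmetric] by (simp add: Ufun_scale mult.left_commute)
    then show "solver_form \<tau> T p (k *\<^sub>R q) = k *\<^sub>R solver_form \<tau> T p q"
      by (simp add: solver_form_def Qfun_scale trace_scaleR elem_int_cmult[symmetric] mult.left_commute
          right_diff_distrib distrib_left)
  qed
next
  fix q
  show "linear (\<lambda>p. solver_form \<tau> T p q)"
  proof (rule linearI)
    fix p r
    have 1: "elem_int T (\<lambda>x. Qfun p x \<bullet> Qfun q x + Qfun r x \<bullet> Qfun q x)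
      = elem_int T (\<lambda>x. Qfun p x \<bullet> Qfun q x) + elem_int T (\<lambda>x. Qfun r x \<bullet> Qfun q x)"
      by (intro elem_int_add T continuous_intros)
    have 2: "elem_int T (\<lambda>x. Ufun p x * trace (fst q) + Ufun r x * trace (fst q))
      = elem_int T (\<lambda>x. Ufun p x * trace (fst q)) + elem_int T (\<lambda>x. Ufun r x * trace (fst q))"
      by (intro elem_int_add T continuous_intros)
    have 3: "elem_int T (\<lambda>x. Qfun p x \<bullet> fst (snd (snd q)) + Qfun r x \<bullet> fst (snd (snd q)))
      = elem_int T (\<lambda>x. Qfun p x \<bullet> fst (snd (snd q))) + elem_int T (\<lambda>x. Qfun r x \<bullet> fst (snd (snd q)))"
      by (intro elem_int_add T continuous_intros)
    let ?b = "\<lambda>p e x. (Qfun p x \<bullet> outer_normal T e + \<tau> * Ufun p x) * Ufun q x"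
    have 4: "bdry_int T (\<lambda>e x. ?b p e x + ?b r e x) = bdry_int T (?b p) + bdry_int T (?b r)"
      by (intro bdry_int_add continuous_intros)
    have 5: "?b (p + r) = (\<lambda>e x. ?b p e x + ?b r e x)"
      by (simp add: Qfun_add Ufun_add inner_add_left algebra_simps)
    show "solver_form \<tau> T (p + r) q = solver_form \<tau> T p q + solver_form \<tau> T r q"
      using 1 2 3 4 unfolding solver_form_def 5
      by (simp add: Qfun_add Ufun_add inner_add_left distrib_right)
  next
    fix p and k :: real
    let ?b = "\<lambda>p e x. (Qfun p x \<bullet> outer_normal T e + \<tau> * Ufun p x) * Ufun q x"
    have "bdry_int T (?b (k *\<^sub>R p)) = k * bdry_int T (?b p)"
      unfolding bdry_int_cmult[symmetric] by (simp add: Ufun_scale Qfun_scale algebra_simps)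
    then show "solver_form \<tau> T (k *\<^sub>R p) q = k *\<^sub>R solver_form \<tau> T p q"
      by (simp add: solver_form_def Qfun_scale Ufun_scale elem_int_cmult[symmetric] mult.assoc
          right_diff_distrib distrib_left)
  qed
qed

lemma linear_solver_rhs:
  assumes m: "\<And>e. e \<in> tri_edges T \<Longrightarrow> continuous_on (convex hull e) (m e)"
  shows "linear (solver_rhs \<tau> T m)"
proof (rule linearI)
  fix q r
  let ?f = "\<lambda>q e x. m e x * (Qfun q x \<bullet> outer_normal T e)" and ?g = "\<lambda>q e x. m e x * Ufun q x"
  have "bdry_int T (\<lambda>e x. ?f q e x + ?f r e x) = bdry_int T (?f q) + bdry_int T (?f r)"
    "bdry_int T (\<lambda>e x. ?g q e x + ?g r e x) = bdry_int T (?g q) + bdry_int T (?g r)"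
    by (intro bdry_int_add continuous_intros m; assumption)+
  then show "solver_rhs \<tau> T m (q + r) = solver_rhs \<tau> T m q + solver_rhs \<tau> T m r"
    by (simp add: solver_rhs_def Qfun_add Ufun_add inner_add_left distrib_left)
next
  fix q and k :: real
  let ?f = "\<lambda>q e x. m e x * (Qfun q x \<bullet> outer_normal T e)" and ?g = "\<lambda>q e x. m e x * Ufun q x"
  have "bdry_int T (?f (k *\<^sub>R q)) = k * bdry_int T (?f q)" "bdry_int T (?g (k *\<^sub>R q)) = k * bdry_int T (?g q)"
    unfolding bdry_int_cmult[symmetric] by (simp_all add: Ufun_scale Qfun_scale mult.left_commute)
  then show "solver_rhs \<tau> T m (k *\<^sub>R q) = k *\<^sub>R solver_rhs \<tau> T m q"
    by (simp add: solver_rhs_def algebra_simps)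
qed

text \<open>By the divergence theorem for the product of \<open>Ufun p\<close> and
  \<open>Qfun p\<close>, the boundary flux cancels both coupling terms; only squares remain.\<close>

lemma solver_form_diag:
  assumes T: "triangle T"
  shows "solver_form \<tau> T p p = elem_int T (\<lambda>x. Qfun p x \<bullet> Qfun p x) + \<tau> * bdry_int T (\<lambda>e x. Ufun p x * Ufun p x)"
proof -
  let ?f = "\<lambda>e x. Ufun p x * (Qfun p x \<bullet> outer_normal T e)" and ?g = "\<lambda>e x. \<tau> * (Ufun p x * Ufun p x)"
  have "bdry_int T (\<lambda>e x. ?f e x + ?g e x) = bdry_int T ?f + bdry_int T ?g"
    by (intro bdry_int_add continuous_intros)
  moreover have "bdry_int T ?f = elem_int T (\<lambda>x. Qfun p x \<bullet> fst (snd (snd p))) + elem_int T (\<lambda>x. Ufun p x * trace (fst p))"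
    using divergence_theorem_triangle[OF T] by (simp add: Ufun_def Qfun_def)
  moreover have "bdry_int T (\<lambda>e x. (Qfun p x \<bullet> outer_normal T e + \<tau> * Ufun p x) * Ufun p x) = bdry_int T (\<lambda>e x. ?f e x + ?g e x)"
    by (simp add: algebra_simps)
  ultimately show ?thesis by (simp add: solver_form_def bdry_int_cmult)
qed

text \<open>Vector and scalar test functions can be chosen independently, so the summed equation for
  all \<open>q\<close> contains both local equations. \<open>E1\<close> depends only on the first
  two components of \<open>q\<close>, \<open>E2\<close> only on the last two.\<close>

lemma local_eqs_iff:
  assumes T: "triangle T" and m: "\<And>e. e \<in> tri_edges T \<Longrightarrow> continuous_on (convex hull e) (m e)"
  shows "local_eqs \<tau> T m (Qfun p) (Ufun p) \<longleftrightarrow> (\<forall>q. solver_form \<tau> T p q = solver_rhs \<tau> T m q)"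
proof -
  have split: "bdry_int T (\<lambda>e x. (Qfun p x \<bullet> outer_normal T e + \<tau> * (Ufun p x - m e x)) * Ufun q x)
    = bdry_int T (\<lambda>e x. (Qfun p x \<bullet> outer_normal T e + \<tau> * Ufun p x) * Ufun q x) - \<tau> * bdry_int T (\<lambda>e x. m e x * Ufun q x)" for q
  proof -
    have "bdry_int T (\<lambda>e x. (Qfun p x \<bullet> outer_normal T e + \<tau> * Ufun p x) * Ufun q x + (- \<tau>) * (m e x * Ufun q x)) =
      bdry_int T (\<lambda>e x. (Qfun p x \<bullet> outer_normal T e + \<tau> * Ufun p x) * Ufun q x) + bdry_int T (\<lambda>e x. (- \<tau>) * (m e x * Ufun q x))"
      by (intro bdry_int_add continuous_intros m; assumption)
    then show ?thesis unfolding bdry_int_cmult by (simp add: algebra_simps)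
  qed
  define E1 where "E1 q \<longleftrightarrow> elem_int T (\<lambda>x. Qfun p x \<bullet> Qfun q x) - elem_int T (\<lambda>x. Ufun p x * trace (fst q))
        = - bdry_int T (\<lambda>e x. m e x * (Qfun q x \<bullet> outer_normal T e))" for q :: params
  define E2 where "E2 q \<longleftrightarrow> - elem_int T (\<lambda>x. Qfun p x \<bullet> fst (snd (snd q)))
        + bdry_int T (\<lambda>e x. (Qfun p x \<bullet> outer_normal T e + \<tau> * (Ufun p x - m e x)) * Ufun q x) = 0" for q :: params
  have "Qfun p \<in> P1vec" "Ufun p \<in> P1" unfolding P1_def P1vec_def Qfun_def Ufun_def by auto
  moreover have "(\<forall>v\<in>P1vec. elem_int T (\<lambda>x. Qfun p x \<bullet> v x) - elem_int T (\<lambda>x. Ufun p x * vdiv v x)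
        = - bdry_int T (\<lambda>e x. m e x * (v x \<bullet> outer_normal T e))) \<longleftrightarrow> (\<forall>A u. E1 (A, u, 0, 0))"
  proof safe
    fix A u
    assume "\<forall>v\<in>P1vec. elem_int T (\<lambda>x. Qfun p x \<bullet> v x) - elem_int T (\<lambda>x. Ufun p x * vdiv v x)
        = - bdry_int T (\<lambda>e x. m e x * (v x \<bullet> outer_normal T e))"
    from bspec[OF this P1vecI[of A u]] show "E1 (A, u, 0, 0)" by (simp add: E1_def Qfun_def vdiv_affine)
  next
    fix v assume E: "\<forall>A u. E1 (A, u, 0, 0)" and "v \<in> P1vec"
    then obtain A u where "v = (\<lambda>x. A *v x + u)" using P1vec_param by blast
    then show "elem_int T (\<lambda>x. Qfun p x \<bullet> v x) - elem_int T (\<lambda>x. Ufun p x * vdiv v x)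
        = - bdry_int T (\<lambda>e x. m e x * (v x \<bullet> outer_normal T e))"
      using E[rule_format, of A u] by (simp add: E1_def Qfun_def vdiv_affine)
  qed
  moreover have "(\<forall>w\<in>P1. - elem_int T (\<lambda>x. Qfun p x \<bullet> grad w x)
        + bdry_int T (\<lambda>e x. (Qfun p x \<bullet> outer_normal T e + \<tau> * (Ufun p x - m e x)) * w x) = 0) \<longleftrightarrow> (\<forall>g k. E2 (0, 0, g, k))"
  proof safe
    fix g k
    assume "\<forall>w\<in>P1. - elem_int T (\<lambda>x. Qfun p x \<bullet> grad w x)
        + bdry_int T (\<lambda>e x. (Qfun p x \<bullet> outer_normal T e + \<tau> * (Ufun p x - m e x)) * w x) = 0"
    from bspec[OF this P1I[of g k]] show "E2 (0, 0, g, k)" by (simp add: E2_def Ufun_def grad_affine)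
  next
    fix w assume E: "\<forall>g k. E2 (0, 0, g, k)" and "w \<in> P1"
    then obtain g k where "w = (\<lambda>x. g \<bullet> x + k)" using P1_param by blast
    then show "- elem_int T (\<lambda>x. Qfun p x \<bullet> grad w x)
        + bdry_int T (\<lambda>e x. (Qfun p x \<bullet> outer_normal T e + \<tau> * (Ufun p x - m e x)) * w x) = 0"
      using E[rule_format, of g k] by (simp add: E2_def Ufun_def grad_affine)
  qed
  ultimately have "local_eqs \<tau> T m (Qfun p) (Ufun p) \<longleftrightarrow> (\<forall>A u. E1 (A, u, 0, 0)) \<and> (\<forall>g k. E2 (0, 0, g, k))"
    unfolding local_eqs_def by blast
  moreover have "E1 (A, u, g, k) \<longleftrightarrow> E1 (A, u, 0, 0)" for A u g k by (simp add: E1_def Qfun_def)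
  moreover have "E2 (A, u, g, k) \<longleftrightarrow> E2 (0, 0, g, k)" for A u g k by (simp add: E2_def Ufun_def)
  ultimately have all: "local_eqs \<tau> T m (Qfun p) (Ufun p) \<longleftrightarrow> (\<forall>q. E1 q \<and> E2 q)"
    unfolding split_paired_All by blast
  \<comment> \<open>With the scalar test function zero, the second equation contributes nothing and
    the sum isolates the first.\<close>
  have E1': "E1 (A, u, 0, 0) \<longleftrightarrow> solver_form \<tau> T p (A, u, 0, 0) = solver_rhs \<tau> T m (A, u, 0, 0)" for A u
  proof -
    have "bdry_int T (\<lambda>e x. 0) = 0" "elem_int T (\<lambda>x. 0) = 0"
      using bdry_int_cmult[of T 0 "\<lambda>e x. 0"] elem_int_cmult[of T 0 "\<lambda>x. 0"] by simp_all
    then show ?thesis by (simp add: E1_def solver_form_def solver_rhs_def Ufun_def)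
  qed
  have sum: "solver_form \<tau> T p q = solver_rhs \<tau> T m q \<longleftrightarrow> E2 q" if "E1 q" for q
    using that unfolding E1_def E2_def solver_form_def solver_rhs_def split by auto
  show ?thesis
  proof
    assume "local_eqs \<tau> T m (Qfun p) (Ufun p)"
    then show "\<forall>q. solver_form \<tau> T p q = solver_rhs \<tau> T m q" using all sum by blast
  next
    assume *: "\<forall>q. solver_form \<tau> T p q = solver_rhs \<tau> T m q"
    have "E1 q" for q
      using E1'[of "fst q" "fst (snd q)"] * by (simp add: E1_def Qfun_def)
    then show "local_eqs \<tau> T m (Qfun p) (Ufun p)" using all sum * by blast
  qed
qed

lemma affine_zero_on_triangle:
  assumes T: "triangle T" and z: "\<And>x. x \<in> T \<Longrightarrow> g \<bullet> x + k = 0"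
  shows "g = 0 \<and> k = 0"
proof -
  obtain a b c where abc: "T = {a, b, c}" and D: "orient a b c > 0"
    using triangle_oriented[OF T] by metis
  have e: "g \<bullet> a + k = 0" "g \<bullet> b + k = 0" "g \<bullet> c + k = 0" using z abc by auto
  then have "g $ 1 * orient a b c = 0" "g $ 2 * orient a b c = 0"
    unfolding orient_def inner_vec_def by (simp_all add: sum_2) algebra+
  then have "g = 0" using D by (simp add: vec_eq_iff forall_2)
  then show ?thesis using e by simp
qed

text \<open>An edge with end values s and t contributes its length times (s^2 + s t + t^2) / 3, and
  the quadratic form is at least s^2 / 2; one edge at \<open>x\<close> is enough.\<close>

lemma bdry_int_square_eq_0:
  assumes T: "triangle T" and z: "bdry_int T (\<lambda>e x. Ufun p x * Ufun p x) \<le> 0" and x: "x \<in> T"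
  shows "Ufun p x = 0"
proof -
  obtain b c where abc: "T = {x, b, c}" and D: "orient x b c > 0"
    using triangle_at_vertex[OF T x] by metis
  have ne: "x \<noteq> b" "x \<noteq> c" "b \<noteq> c" using orient_pos_distinct[OF D] by auto
  have e: "edge_int {y, w} (\<lambda>x. Ufun p x * Ufun p x) = dist y w * ((Ufun p y ^ 2 + Ufun p y * Ufun p w + Ufun p w ^ 2) / 3)"
    if "y \<noteq> w" for y w
  proof -
    have "Ufun p ((1 - t) *\<^sub>R y + t *\<^sub>R w) = (1 - t) * Ufun p y + t * Ufun p w" for t
      unfolding Ufun_def affine_on_segment ..
    from edge_int_affine_mult[OF that this this] show ?thesis by (simp add: power2_eq_square algebra_simps)
  qed
  have nn: "s ^ 2 / 2 \<le> s ^ 2 + s * t + t ^ 2" for s t :: real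
    using sum_squares_ge_zero[of "s + t" t] by (simp add: power2_eq_square algebra_simps)
  have nn0: "0 \<le> s ^ 2 + s * t + t ^ 2" for s t :: real
    using nn[of s t] zero_le_power2[of s] by linarith
  have "edge_int {x, b} (\<lambda>x. Ufun p x * Ufun p x) \<le> 0"
    using z ne unfolding abc bdry_int_eq[OF D] e[OF ne(1)] e[OF ne(3)] e[OF ne(2)[symmetric]]
    using mult_nonneg_nonneg[OF zero_le_dist[of b c] nn0[of "Ufun p b" "Ufun p c"]]
      mult_nonneg_nonneg[OF zero_le_dist[of c x] nn0[of "Ufun p c" "Ufun p x"]] by linarith
  then have "Ufun p x ^ 2 + Ufun p x * Ufun p b + Ufun p b ^ 2 \<le> 0"
    using ne unfolding e[OF ne(1)] by (simp add: mult_le_0_iff)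
  then have "Ufun p x ^ 2 \<le> 0" using nn[of "Ufun p x" "Ufun p b"] by linarith
  then show ?thesis by simp
qed

text \<open>A nonnegative integrand with zero integral vanishes almost everywhere. If a component of
  the affine field were not identically zero, its zeros would form a null set and the triangle could
  not have positive area.\<close>

lemma elem_int_square_eq_0:
  assumes T: "triangle T" and z: "elem_int T (\<lambda>x. Qfun p x \<bullet> Qfun p x) \<le> 0"
  shows "fst p = 0 \<and> fst (snd p) = 0"
proof -
  let ?f = "\<lambda>x. indicator (convex hull T) x *\<^sub>R (Qfun p x \<bullet> Qfun p x)"
  have nn: "0 \<le> elem_int T (\<lambda>x. Qfun p x \<bullet> Qfun p x)" by (rule elem_int_nonneg) simp
  have "integrable lborel ?f"
    using set_integrable_triangle[OF T, of "\<lambda>x. Qfun p x \<bullet> Qfun p x"]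
    by (simp add: set_integrable_def continuous_intros)
  moreover have "integral\<^sup>L lborel ?f = 0"
    using antisym[OF z nn] by (simp add: elem_int_def set_lebesgue_integral_def)
  ultimately have "AE x in lborel. ?f x = 0"
    by (subst (asm) integral_nonneg_eq_0_iff_AE) auto
  then have AE: "AE x in lborel. x \<in> convex hull T \<longrightarrow> Qfun p x = 0"
    by eventually_elim (auto simp: indicator_def)
  have meas: "convex hull T \<in> sets lborel" using compact_triangle[OF T] by (simp add: compact_imp_closed)
  have pos: "measure lborel (convex hull T) > 0"
    using triangle_oriented[OF T] measure_triangle by (metis half_gt_zero)
  have "row i (fst p) = 0 \<and> fst (snd p) $ i = 0" for i
  proof (rule ccontr)
    assume "\<not> ?thesis"
    \<comment> \<open>This includes the case of a zero row with a nonzero constant, where the set is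
      empty.\<close>
    then have "negligible {x. row i (fst p) \<bullet> x = - fst (snd p) $ i}"
      by (intro negligible_hyperplane) auto
    then have "AE x in lebesgue. x \<notin> {x. row i (fst p) \<bullet> x = - fst (snd p) $ i}"
      using AE_not_in negligible_iff_null_sets by blast
    moreover have "AE x in lebesgue. x \<in> convex hull T \<longrightarrow> Qfun p x = 0"
      using AE by (rule AE_completion)
    ultimately have "AE x in lebesgue. x \<notin> convex hull T"
    proof eventually_elim
      case (elim x)
      have "Qfun p x $ i = row i (fst p) \<bullet> x + fst (snd p) $ i"
        by (simp add: Qfun_def row_def matrix_vector_mult_def inner_vec_def)
      then show ?case using elim by (auto simp: add_eq_0_iff)
    qed
    then have "convex hull T \<in> null_sets lebesgue" using meas by (simp add: AE_iff_null_sets)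
    then have "measure lebesgue (convex hull T) = 0" by (rule measure_eq_0_null_sets)
    then show False using pos meas by simp
  qed
  then show ?thesis by (simp add: vec_eq_iff row_def)
qed

text \<open>This gives meaning to the definite description in \<open>local_solver\<close>.
  Definiteness of the form: the element term kills the field, and as \<tau> is positive the boundary
  term kills the scalar function at the vertices, hence everywhere.\<close>

lemma local_eqs_ex1:
  assumes T: "triangle T" and "\<tau> > 0" and m: "\<And>e. e \<in> tri_edges T \<Longrightarrow> continuous_on (convex hull e) (m e)"
  shows "\<exists>!p. local_eqs \<tau> T m (fst p) (snd p)"
proof -
  have "p = 0" if "solver_form \<tau> T p p = 0" for p
  proof -
    have Q: "0 \<le> elem_int T (\<lambda>x. Qfun p x \<bullet> Qfun p x)" by (rule elem_int_nonneg) simp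
    have "0 \<le> bdry_int T (\<lambda>e x. Ufun p x * Ufun p x)"
      using bdry_int_mono[of T "\<lambda>e x. 0 * 0" "\<lambda>e x. Ufun p x * Ufun p x"] bdry_int_cmult[of T 0 "\<lambda>e x. 0"]
      by (simp add: continuous_intros)
    with Q that have "elem_int T (\<lambda>x. Qfun p x \<bullet> Qfun p x) \<le> 0" "bdry_int T (\<lambda>e x. Ufun p x * Ufun p x) \<le> 0"
      unfolding solver_form_diag[OF T] using \<open>\<tau> > 0\<close>
      by (smt (verit) mult_nonneg_nonneg, smt (verit) mult_pos_pos)
    then have "fst p = 0 \<and> fst (snd p) = 0" and U: "\<And>x. x \<in> T \<Longrightarrow> Ufun p x = 0"
      using elem_int_square_eq_0[OF T] bdry_int_square_eq_0[OF T] by blast+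
    moreover have "fst (snd (snd p)) = 0 \<and> snd (snd (snd p)) = 0"
      by (rule affine_zero_on_triangle[OF T]) (use U in \<open>simp add: Ufun_def\<close>)
    ultimately show "p = 0" by (simp add: prod_eq_iff)
  qed
  then have "\<exists>!p. \<forall>q. solver_form \<tau> T p q = solver_rhs \<tau> T m q"
    by (intro finite_dim_solvable[OF bilinear_solver_form[OF T] linear_solver_rhs[OF m]])
  then obtain p where p: "\<forall>q. solver_form \<tau> T p q = solver_rhs \<tau> T m q"
    and uniq: "\<And>p'. \<forall>q. solver_form \<tau> T p' q = solver_rhs \<tau> T m q \<Longrightarrow> p' = p"
    unfolding Ex1_def by blast
  show ?thesis
  proof (rule ex1I[of _ "(Qfun p, Ufun p)"])
    show "local_eqs \<tau> T m (fst (Qfun p, Ufun p)) (snd (Qfun p, Ufun p))"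
      using local_eqs_iff[OF T m] p by simp
  next
    fix f assume f: "local_eqs \<tau> T m (fst f) (snd f)"
    then have "fst f \<in> P1vec" "snd f \<in> P1" by (simp_all add: local_eqs_def)
    then obtain A u g k where Au: "fst f = (\<lambda>x. A *v x + u)" and gk: "snd f = (\<lambda>x. g \<bullet> x + k)"
      using P1vec_param P1_param by metis
    have Q: "fst f = Qfun (A, u, g, k)" and U: "snd f = Ufun (A, u, g, k)"
      using Au gk by (simp_all add: Qfun_def Ufun_def fun_eq_iff)
    have "(A, u, g, k) = p" using f local_eqs_iff[OF T m, of \<tau> "(A, u, g, k)"] unfolding Q U by (intro uniq) blast
    then show "f = (Qfun p, Ufun p)" using Q U by (simp add: prod_eq_iff)
  qed
qed

lemma local_solver_eqs:
  assumes "triangle T" and "\<tau> > 0" and "\<And>e. e \<in> tri_edges T \<Longrightarrow> continuous_on (convex hull e) (m e)"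
  shows "local_eqs \<tau> T m (lsQ \<tau> T m) (lsU \<tau> T m)"
  unfolding lsQ_def lsU_def local_solver_def by (rule theI'[OF local_eqs_ex1[OF assms]])

text \<open>For the trace of an affine function the stabilization residual is zero, and both
  equations reduce to the divergence theorem; uniqueness identifies the solution.\<close>

lemma local_solver_affine:
  assumes T: "triangle T" and "\<tau> > 0"
    and m: "\<And>e x. e \<in> tri_edges T \<Longrightarrow> x \<in> convex hull e \<Longrightarrow> m e x = g \<bullet> x + k"
  shows "lsQ \<tau> T m = (\<lambda>x. - g)" and "lsU \<tau> T m = (\<lambda>x. g \<bullet> x + k)"
proof -
  have cont: "continuous_on (convex hull e) (m e)" if "e \<in> tri_edges T" for e
  proof -
    have "continuous_on (convex hull e) (\<lambda>x. g \<bullet> x + k)" by (intro continuous_intros)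
    then show ?thesis using m[OF that] by (simp cong: continuous_on_cong)
  qed
  have "local_eqs \<tau> T m (\<lambda>x. - g) (\<lambda>x. g \<bullet> x + k)"
    unfolding local_eqs_def
  proof (intro conjI ballI)
    show "(\<lambda>x. - g) \<in> P1vec" using P1vecI[of 0 "- g"] by simp
    show "(\<lambda>x. g \<bullet> x + k) \<in> P1" by (rule P1I)
  next
    fix v assume "v \<in> P1vec"
    then obtain A u where v: "v = (\<lambda>x. A *v x + u)" by (rule P1vec_param)
    have "elem_int T (\<lambda>x. - g \<bullet> v x) = - elem_int T (\<lambda>x. v x \<bullet> g)"
      using elem_int_cmult[of T "-1" "\<lambda>x. v x \<bullet> g"] by (simp add: inner_commute)
    moreover have "bdry_int T (\<lambda>e x. m e x * (v x \<bullet> outer_normal T e))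
        = bdry_int T (\<lambda>e x. (g \<bullet> x + k) * (v x \<bullet> outer_normal T e))"
      by (rule bdry_int_cong) (simp add: m)
    ultimately show "elem_int T (\<lambda>x. - g \<bullet> v x) - elem_int T (\<lambda>x. (g \<bullet> x + k) * vdiv v x)
        = - bdry_int T (\<lambda>e x. m e x * (v x \<bullet> outer_normal T e))"
      using divergence_theorem_triangle[OF T, of A u g k] unfolding v vdiv_affine by simp
  next
    fix w assume "w \<in> P1"
    then obtain h j where w: "w = (\<lambda>x. h \<bullet> x + j)" by (rule P1_param)
    have "bdry_int T (\<lambda>e x. (- g \<bullet> outer_normal T e + \<tau> * (g \<bullet> x + k - m e x)) * w x)
        = bdry_int T (\<lambda>e x. w x * (- g \<bullet> outer_normal T e))"
      by (rule bdry_int_cong) (simp add: m)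
    then show "- elem_int T (\<lambda>x. - g \<bullet> grad w x)
        + bdry_int T (\<lambda>e x. (- g \<bullet> outer_normal T e + \<tau> * (g \<bullet> x + k - m e x)) * w x) = 0"
      using divergence_theorem_triangle[OF T, of 0 "- g" h j] elem_int_cmult[of T 0 "\<lambda>x. 0"]
      unfolding w grad_affine by (simp add: trace_def)
  qed
  with local_solver_eqs[OF T \<open>\<tau> > 0\<close> cont] local_eqs_ex1[OF T \<open>\<tau> > 0\<close> cont]
  have "(lsQ \<tau> T m, lsU \<tau> T m) = (\<lambda>x. - g, \<lambda>x. g \<bullet> x + k)" by (metis fst_conv snd_conv)
  then show "lsQ \<tau> T m = (\<lambda>x. - g)" and "lsU \<tau> T m = (\<lambda>x. g \<bullet> x + k)" by simp_all
qed

section \<open>The star of a vertex\<close>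

lemma orient_in_edge_hull: "x \<in> convex hull {a, b} \<Longrightarrow> orient a b x = 0"
proof -
  assume "x \<in> convex hull {a, b}"
  then obtain u where u: "x = (1 - u) *\<^sub>R a + u *\<^sub>R b"
    unfolding segment_convex_hull[symmetric] closed_segment_def by auto
  show ?thesis unfolding u by (simp add: orient_def algebra_simps)
qed

lemma in_open_edge:
  assumes D: "orient a b c > 0" and x: "orient a b x = 0" "orient b c x > 0" "orient c a x > 0"
  shows "x \<in> open_segment a b"
proof -
  let ?D = "orient a b c" and ?u = "orient c a x / orient a b c"
  have s: "orient b c x + orient c a x = ?D" using orient_sum[of b c x a] x by simp
  have "x = (1 / ?D) *\<^sub>R (?D *\<^sub>R x)" using D by simp
  also have "\<dots> = (orient b c x / ?D) *\<^sub>R a + ?u *\<^sub>R b"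
    unfolding barycentric[of a b c x] by (simp add: scaleR_add_right x)
  also have "orient b c x / ?D = 1 - ?u" using s D by (simp add: field_simps)
  finally have "x = (1 - ?u) *\<^sub>R a + ?u *\<^sub>R b" .
  moreover have "0 < ?u" "?u < 1" using x s D by (auto simp: field_simps)
  ultimately show ?thesis using orient_pos_distinct[OF D] unfolding in_segment by blast
qed

lemma orient_open_edge:
  assumes "x \<in> open_segment a b"
  shows "orient a b x = 0" "orient b a c > 0 \<Longrightarrow> orient a c x > 0" "orient b a c > 0 \<Longrightarrow> orient c b x > 0"
proof -
  obtain u where u: "0 < u" "u < 1" "x = (1 - u) *\<^sub>R a + u *\<^sub>R b" using assms by (auto simp: in_segment)
  show "orient a b x = 0" unfolding u by (simp add: orient_def algebra_simps)
  have "orient a c x = u * orient b a c" "orient c b x = (1 - u) * orient b a c"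
    unfolding u by (simp_all add: orient_def algebra_simps)
  then show "orient b a c > 0 \<Longrightarrow> orient a c x > 0" "orient b a c > 0 \<Longrightarrow> orient c b x > 0"
    using u by simp_all
qed

lemma open_orient_pos: "open {w. orient a b w > 0}"
  by (intro open_Collect_less continuous_intros)

text \<open>The open set \<open>?W\<close> imposes the strict conditions of the four edges other
  than the common one. Each of its points lies in one of the two triangles according to the sign of
  \<open>orient a b\<close>.\<close>

lemma interior_two_sided:
  assumes c: "orient a b c > 0" and c': "orient b a c' > 0" and x: "x \<in> open_segment a b"
  shows "x \<in> interior (convex hull {a, b, c} \<union> convex hull {a, b, c'})"
proof (rule interiorI)
  let ?W = "{w. orient b c w > 0} \<inter> {w. orient c a w > 0} \<inter> {w. orient a c' w > 0} \<inter> {w. orient c' b w > 0}"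
  show "open ?W" by (intro open_Int open_orient_pos)
  have x': "x \<in> open_segment b a" using x by (simp add: open_segment_commute)
  show "x \<in> ?W"
    using orient_open_edge(2,3)[OF x' c] orient_open_edge(2,3)[OF x c'] by simp
  show "?W \<subseteq> convex hull {a, b, c} \<union> convex hull {a, b, c'}"
  proof
    fix w assume w: "w \<in> ?W"
    have e: "{a, b, c'} = {b, a, c'}" by auto
    show "w \<in> convex hull {a, b, c} \<union> convex hull {a, b, c'}"
      using w in_triangle_hull_iff[OF c, of w] in_triangle_hull_iff[OF c', of w] orient_swap[of a b w] unfolding e
      by (cases "orient a b w \<ge> 0") auto
  qed
qed

lemma conforming_triangle: "conforming_triangulation \<Omega> Th \<Longrightarrow> T \<in> Th \<Longrightarrow> triangle T"
  by (simp add: conforming_triangulation_def)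

lemma conforming_hull_Int:
  "conforming_triangulation \<Omega> Th \<Longrightarrow> T \<in> Th \<Longrightarrow> T' \<in> Th \<Longrightarrow> T \<noteq> T' \<Longrightarrow>
    convex hull T \<inter> convex hull T' = convex hull (T \<inter> T')"
  by (simp add: conforming_triangulation_def)

lemma triangle_not_affine_dependent: "triangle {a, b, c} \<Longrightarrow> \<not> affine_dependent {a, b, c}"
  by (auto simp: triangle_def collinear_3_eq_affine_dependent)

text \<open>From a point \<open>q\<close> of the open edge inside \<Omega>, a short step away from
  \<open>c\<close> reaches a point \<open>x\<close> that some other triangle must cover. If the step
  is short enough, this triangle also contains \<open>q\<close>, and conformity makes
  \<open>a\<close> and \<open>b\<close> two of its vertices.\<close>

lemma triangle_across_edge:
  assumes conf: "conforming_triangulation \<Omega> Th" and "open \<Omega>"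
    and T: "{a, b, c} \<in> Th" and D: "orient a b c > 0" and inner: "\<not> convex hull {a, b} \<subseteq> frontier \<Omega>"
  shows "\<exists>c'. {a, b, c'} \<in> Th \<and> orient b a c' > 0"
proof -
  let ?T = "{a, b, c}"
  have fin: "finite Th" and cover: "(\<Union>T\<in>Th. convex hull T) = closure \<Omega>"
    using conf by (auto simp: conforming_triangulation_def)
  have ne: "a \<noteq> b" using orient_pos_distinct[OF D] by simp
  obtain p where p: "p \<in> convex hull {a, b}" "p \<notin> frontier \<Omega>" using inner by blast
  have "convex hull {a, b} \<subseteq> convex hull ?T" by (rule hull_mono) auto
  then have "p \<in> closure \<Omega>" using p T cover by blast
  then have "p \<in> \<Omega>" using p \<open>open \<Omega>\<close> by (simp add: frontier_def interior_open)
  moreover have "p \<in> closure (open_segment a b)"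
    using p ne by (simp add: segment_convex_hull closure_open_segment)
  \<comment> \<open>The open segment is dense in the edge, so the point of \<Omega> can be moved off
    the endpoints.\<close>
  ultimately obtain q where q: "q \<in> open_segment a b" "q \<in> \<Omega>"
    using \<open>open \<Omega>\<close> by (meson closure_iff_nhds_not_empty disjoint_iff subset_refl)
  \<comment> \<open>Near \<open>q\<close>, outside this closed union, every triangle met contains
    \<open>q\<close> itself.\<close>
  let ?F = "\<Union>T\<in>{T\<in>Th. q \<notin> convex hull T}. convex hull T"
  have "closed ?F"
    using fin conforming_triangle[OF conf] by (intro closed_UN) (auto intro: compact_triangle compact_imp_closed)
  from open_Diff[OF \<open>open \<Omega>\<close> this] have "open (\<Omega> - ?F)" .
  moreover have "q \<in> \<Omega> - ?F" using q by auto
  ultimately obtain \<epsilon> where \<epsilon>: "\<epsilon> > 0" "ball q \<epsilon> \<subseteq> \<Omega> - ?F" by (meson openE)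
  \<comment> \<open>The \<open>+ 1\<close> keeps the denominator positive without an argument that
    \<open>c\<close> differs from \<open>q\<close>.\<close>
  define t where "t = \<epsilon> / (2 * (norm (c - q) + 1))"
  have t: "t > 0" "t * norm (c - q) < \<epsilon>"
  proof -
    have n: "0 < 2 * (norm (c - q) + 1)" by (smt (verit) norm_ge_zero)
    then show "t > 0" using \<epsilon> by (simp add: t_def)
    have "t * norm (c - q) = \<epsilon> * (norm (c - q) / (2 * (norm (c - q) + 1)))" by (simp add: t_def)
    also have "\<dots> < \<epsilon> * 1"
      using \<epsilon> n by (intro mult_strict_left_mono) (auto simp: divide_less_eq)
    finally show "t * norm (c - q) < \<epsilon>" by simp
  qed
  define x where "x = q - t *\<^sub>R (c - q)"
  have "orient a b q = 0" using orient_open_edge(1)[OF q(1)] .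
  then have ox: "orient a b x < 0"
  proof -
    have "orient a b x = (1 + t) * orient a b q - t * orient a b c"
      unfolding x_def orient_def by (simp add: algebra_simps)
    then show ?thesis using \<open>orient a b q = 0\<close> t D by simp
  qed
  have "x \<in> ball q \<epsilon>" using t by (simp add: x_def dist_norm)
  then have x: "x \<in> \<Omega>" "x \<notin> ?F" using \<epsilon> by auto
  then obtain T' where T': "T' \<in> Th" "x \<in> convex hull T'" using cover closure_subset by blast
  then have qT': "q \<in> convex hull T'" using x by blast
  have "x \<notin> convex hull ?T" using ox in_triangle_hull_iff[OF D] by auto
  then have "T' \<noteq> ?T" using T' by auto
  have "open_segment a b \<subseteq> convex hull {a, b}" by (auto simp: segment_convex_hull[symmetric] open_segment_def)
  with q have q2: "q \<in> convex hull {a, b}" by auto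
  then have "q \<in> convex hull ?T" using \<open>convex hull {a, b} \<subseteq> convex hull ?T\<close> by auto
  then have "q \<in> convex hull (?T \<inter> T')" using conforming_hull_Int[OF conf T T'(1)] \<open>T' \<noteq> ?T\<close> qT' by auto
  \<comment> \<open>Hulls of subsets of affinely independent vertices meet in the hull of the common
    vertices. If \<open>a\<close> or \<open>b\<close> were missing from \<open>T'\<close>,
    \<open>q\<close> would be an endpoint of the edge.\<close>
  moreover have "convex hull ((?T \<inter> T') \<inter> {a, b}) = convex hull (?T \<inter> T') \<inter> convex hull {a, b}"
  proof (rule convex_hull_Int)
    show "\<not> affine_dependent (?T \<inter> T' \<union> {a, b})"
      using triangle_not_affine_dependent[OF triangle_orient[OF D]]
      by (rule affine_independent_subset) auto
  qed
  ultimately have q3: "q \<in> convex hull ((?T \<inter> T') \<inter> {a, b})" using q2 by auto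
  have "a \<in> T'"
  proof (rule ccontr)
    assume "a \<notin> T'"
    then have "convex hull ((?T \<inter> T') \<inter> {a, b}) \<subseteq> convex hull {b}" by (intro hull_mono) auto
    then show False using q3 q by (auto simp: open_segment_def)
  qed
  have "b \<in> T'"
  proof (rule ccontr)
    assume "b \<notin> T'"
    then have "convex hull ((?T \<inter> T') \<inter> {a, b}) \<subseteq> convex hull {a}" by (intro hull_mono) auto
    then show False using q3 q by (auto simp: open_segment_def)
  qed
  have "card T' = 3" using conforming_triangle[OF conf T'(1)] by (simp add: triangle_def)
  then have "card (T' - {a, b}) = 1" using \<open>a \<in> T'\<close> \<open>b \<in> T'\<close> ne by (simp add: card_Diff_subset)
  then obtain c' where "T' - {a, b} = {c'}" by (auto simp: card_1_singleton_iff)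
  then have T'eq: "T' = {a, b, c'}" using \<open>a \<in> T'\<close> \<open>b \<in> T'\<close> by auto
  obtain u v w where uvw: "0 \<le> u" "0 \<le> v" "0 \<le> w" "u + v + w = 1" "x = u *\<^sub>R a + v *\<^sub>R b + w *\<^sub>R c'"
    using T'(2) by (auto simp: T'eq convex_hull_3)
  \<comment> \<open>\<open>orient a b\<close> is affine and vanishes at \<open>a\<close> and
    \<open>b\<close>, so only \<open>c'\<close> can make it negative at \<open>x\<close>.\<close>
  then have "w * orient a b c' < 0" using ox by (simp add: orient_affine)
  then have "orient a b c' < 0" using uvw by (simp add: mult_less_0_iff)
  then have "orient b a c' > 0" using orient_swap[of a b c'] by simp
  then show ?thesis using T'(1) T'eq by blast
qed

section \<open>Filling a punctured disc around a vertex\<close>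

lemma interior_point_near_vertex:
  assumes D: "orient z y c > 0" and "r > 0"
  obtains w where "w \<in> ball z r - {z}" "orient z y w > 0" "orient y c w > 0" "orient c z w > 0"
proof -
  let ?v = "(y - z) + (c - z)"
  \<comment> \<open>The point \<open>z + t *\<^sub>R ?v\<close> has barycentric coordinates 1 - 2 t,
    t, t; the bound 1/4 keeps the first one positive and the other bound keeps the point in the
    ball.\<close>
  define t where "t = min (1/4) (r / (2 * (norm ?v + 1)))"
  have n: "0 < 2 * (norm ?v + 1)" by (smt (verit) norm_ge_zero)
  have t: "t > 0" "t \<le> 1/4" "t \<le> r / (2 * (norm ?v + 1))"
    unfolding t_def using \<open>r > 0\<close> n
      min.cobounded1[of "1/4" "r / (2 * (norm ?v + 1))"] min.cobounded2[of "1/4" "r / (2 * (norm ?v + 1))"]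
    by (simp only: min_less_iff_conj, simp)+
  have "t * norm ?v \<le> r / (2 * (norm ?v + 1)) * norm ?v"
    by (intro mult_right_mono t) simp
  also have "\<dots> = r * (norm ?v / (2 * (norm ?v + 1)))" by simp
  also have "\<dots> < r * 1"
    using \<open>r > 0\<close> n by (intro mult_strict_left_mono) (auto simp: divide_less_eq)
  finally have tr: "t * norm ?v < r" by simp
  define w where "w = z + t *\<^sub>R ?v"
  have e: "orient z y w = t * orient z y c" "orient c z w = t * orient z y c" "orient y c w = (1 - 2 * t) * orient z y c"
    unfolding w_def orient_def by (simp_all add: algebra_simps)
  then have pos: "orient z y w > 0" "orient y c w > 0" "orient c z w > 0" using t D by simp_all
  then have "w \<noteq> z" by auto
  moreover have "w \<in> ball z r" using tr t by (simp add: w_def dist_norm)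
  ultimately show thesis using pos that by auto
qed

text \<open>A different triangle would share at most two vertices, so by conformity \<open>w\<close>
  would lie on an edge, where one of the orientations vanishes.\<close>

lemma triangle_interior_unique:
  assumes conf: "conforming_triangulation \<Omega> Th" and T: "{a, b, c} \<in> Th" "T' \<in> Th"
    and w: "orient a b w > 0" "orient b c w > 0" "orient c a w > 0" "w \<in> convex hull T'"
  shows "T' = {a, b, c}"
proof (rule ccontr)
  assume ne: "T' \<noteq> {a, b, c}"
  have D: "orient a b c > 0" using orient_sum[of b c w a] w by simp
  have "w \<in> convex hull {a, b, c}" using in_triangle_hull_iff[OF D] w by auto
  then have w': "w \<in> convex hull ({a, b, c} \<inter> T')"
    using conforming_hull_Int[OF conf T] ne w by auto
  have "card {a, b, c} = 3" "card T' = 3"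
    using conforming_triangle[OF conf] T by (auto simp: triangle_def)
  then have "\<not> {a, b, c} \<subseteq> T'" using ne by (metis card_subset_eq card.infinite zero_neq_numeral)
  then have "{a, b, c} \<inter> T' \<subseteq> {a, b} \<or> {a, b, c} \<inter> T' \<subseteq> {b, c} \<or> {a, b, c} \<inter> T' \<subseteq> {c, a}" by auto
  then have "w \<in> convex hull {a, b} \<or> w \<in> convex hull {b, c} \<or> w \<in> convex hull {c, a}"
    using w' hull_mono by (metis subsetD)
  then show False using orient_in_edge_hull w by fastforce
qed

text \<open>The union of the triangles in \<open>K\<close> is both closed and open in a small punctured disc around \<open>z\<close>.\<close>
lemma star_eq_of_adjacency_closed:
  assumes conf: "conforming_triangulation \<Omega> Th" and "open \<Omega>"
    and K: "K \<subseteq> {T\<in>Th. z \<in> T}" "K \<noteq> {}"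
    and closed: "\<And>T T' y. T \<in> K \<Longrightarrow> T' \<in> Th \<Longrightarrow> y \<noteq> z \<Longrightarrow> {z, y} \<subseteq> T \<Longrightarrow> {z, y} \<subseteq> T' \<Longrightarrow> T' \<in> K"
    and inner: "\<And>T y. T \<in> K \<Longrightarrow> y \<in> T \<Longrightarrow> y \<noteq> z \<Longrightarrow> \<not> convex hull {z, y} \<subseteq> frontier \<Omega>"
  shows "K = {T\<in>Th. z \<in> T}"
proof -
  have fin: "finite K" using conf K(1) by (auto simp: conforming_triangulation_def intro: finite_subset)
  have tri: "triangle T" "z \<in> T" "T \<in> Th" if "T \<in> K" for T using that K conforming_triangle[OF conf] by auto
  \<comment> \<open>The sides opposite to \<open>z\<close>. They stay away from \<open>z\<close>, so
    in a small disc only the two edges at \<open>z\<close> bound each triangle of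
    \<open>K\<close>.\<close>
  let ?F = "\<Union>T\<in>K. convex hull (T - {z})" and ?S = "\<Union>T\<in>K. convex hull T"
  have F: "closed ?F"
    using fin tri by (intro closed_UN ballI compact_imp_closed finite_imp_compact_convex_hull)
      (auto simp: triangle_def card_ge_0_finite)
  have S: "closed ?S"
    using fin tri by (intro closed_UN ballI compact_imp_closed compact_triangle) auto
  have "z \<notin> ?F"
  proof
    assume "z \<in> ?F"
    then obtain T where T: "T \<in> K" "z \<in> convex hull (T - {z})" by auto
    obtain y c where yc: "T = {z, y, c}" "orient z y c > 0" "z \<noteq> y" "z \<noteq> c"
      using triangle_at_vertex[OF tri(1,2)[OF T(1)]] by metis
    then have "T - {z} = {y, c}" by auto
    then have "orient y c z = 0" using T orient_in_edge_hull by auto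
    then show False using yc by (simp add: orient_rotate[of y c z])
  qed
  then obtain r where r: "r > 0" "ball z r \<subseteq> - ?F"
    using F by (meson ComplI open_Compl openE)
  let ?B = "ball z r - {z}"
  \<comment> \<open>This is openness: the covered part of the punctured disc consists of interior
    points of \<open>?S\<close>.\<close>
  have key: "x \<in> interior ?S" if x: "x \<in> ?B" "x \<in> ?S" for x
  proof -
    obtain T where T: "T \<in> K" "x \<in> convex hull T" using x by auto
    obtain y c where yc: "T = {z, y, c}" and D: "orient z y c > 0" and ne: "z \<noteq> y" "z \<noteq> c" "y \<noteq> c"
      using triangle_at_vertex[OF tri(1,2)[OF T(1)]] by metis
    have D2: "orient c z y > 0" using D orient_rotate[of z y c] by simp
    have T2: "T = {c, z, y}" using yc by auto
    have o: "orient z y x \<ge> 0" "orient y c x \<ge> 0" "orient c z x \<ge> 0"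
      using T(2) in_triangle_hull_iff[OF D] yc by auto
    have "T - {z} = {y, c}" using yc ne by auto
    moreover have "x \<notin> ?F" using r x by blast
    ultimately have xF: "x \<notin> convex hull {y, c}" using T(1) by (metis UN_I)
    have bary: "orient z y c *\<^sub>R x = orient y c x *\<^sub>R z + orient c z x *\<^sub>R y + orient z y x *\<^sub>R c"
      by (rule barycentric)
    have sum: "orient y c x + orient c z x + orient z y x = orient z y c" by (rule orient_sum)
    have o2: "orient y c x > 0"
    proof (rule ccontr)
      assume "\<not> orient y c x > 0"
      then have 0: "orient y c x = 0" using o by simp
      let ?u = "orient z y x / orient z y c"
      have "x = (1 / orient z y c) *\<^sub>R (orient z y c *\<^sub>R x)" using D by simp
      also have "\<dots> = (orient c z x / orient z y c) *\<^sub>R y + ?u *\<^sub>R c"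
        unfolding bary by (simp add: 0 scaleR_add_right)
      also have "orient c z x / orient z y c = 1 - ?u" using sum 0 D by (simp add: field_simps)
      finally have "x = (1 - ?u) *\<^sub>R y + ?u *\<^sub>R c" .
      moreover have "?u \<in> {0..1}" using o sum D by (auto simp: field_simps)
      ultimately show False using xF edge_param_in_hull by metis
    qed
    have "x \<noteq> z" using x by simp
    have "\<not> (orient z y x = 0 \<and> orient c z x = 0)"
    proof
      assume "orient z y x = 0 \<and> orient c z x = 0"
      then have "orient z y c *\<^sub>R x = orient z y c *\<^sub>R z" using bary sum by simp
      then show False using D \<open>x \<noteq> z\<close> by simp
    qed
    \<comment> \<open>The point is inside the triangle or on one of its two open edges at
      \<open>z\<close>. In the edge cases \<open>inner\<close> provides the triangle on the other
      side and \<open>closed\<close> puts it into \<open>K\<close>.\<close>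
    then consider "orient z y x > 0" "orient c z x > 0" | "orient z y x = 0" "orient c z x > 0" | "orient c z x = 0" "orient z y x > 0"
      using o by linarith
    then show ?thesis
    proof cases
      case 1
      let ?W = "{w. orient z y w > 0} \<inter> {w. orient y c w > 0} \<inter> {w. orient c z w > 0}"
      have "open ?W" by (intro open_Int open_orient_pos)
      moreover have "?W \<subseteq> convex hull T" by (auto simp: yc in_triangle_hull_iff[OF D])
      then have "?W \<subseteq> ?S" using T(1) by blast
      moreover have "x \<in> ?W" using 1 o2 by simp
      ultimately show ?thesis by (meson interiorI)
    next
      case 2
      have xs: "x \<in> open_segment z y" using in_open_edge[OF D 2(1) o2 2(2)] .
      have "\<not> convex hull {z, y} \<subseteq> frontier \<Omega>" using inner[OF T(1), of y] ne by (simp add: yc)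
      then obtain c' where c': "{z, y, c'} \<in> Th" "orient y z c' > 0"
        using triangle_across_edge[OF conf \<open>open \<Omega>\<close> tri(3)[OF T(1), unfolded yc] D] by blast
      have "{z, y, c'} \<in> K" using closed[OF T(1) c'(1), of y] ne by (simp add: yc)
      then have "convex hull {z, y, c} \<union> convex hull {z, y, c'} \<subseteq> ?S" using T(1) unfolding yc by blast
      then show ?thesis using interior_two_sided[OF D c'(2) xs] interior_mono by blast
    next
      case 3
      have xs: "x \<in> open_segment c z" using in_open_edge[OF D2 3(1) 3(2) o2] .
      have "\<not> convex hull {c, z} \<subseteq> frontier \<Omega>" using inner[OF T(1), of c] ne by (simp add: yc insert_commute[of c z])
      then obtain c' where c': "{c, z, c'} \<in> Th" "orient z c c' > 0"
        using triangle_across_edge[OF conf \<open>open \<Omega>\<close> tri(3)[OF T(1), unfolded T2] D2] by blast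
      have "{c, z, c'} \<in> K" using closed[OF T(1) c'(1), of c] ne by (simp add: yc)
      then have "convex hull {c, z, y} \<union> convex hull {c, z, c'} \<subseteq> ?S" using T(1) unfolding T2 by blast
      then show ?thesis using interior_two_sided[OF D2 c'(2) xs] interior_mono by blast
    qed
  qed
  \<comment> \<open>A punctured disc in the plane is connected, so it cannot be split into the open
    sets \<open>interior ?S\<close> and \<open>- ?S\<close>.\<close>
  have conn: "connected ?B" by (rule connected_punctured_ball) simp
  have cov: "?B \<subseteq> interior ?S \<union> - ?S" using key by blast
  have disj: "interior ?S \<inter> - ?S \<inter> ?B = {}" using interior_subset[of ?S] by blast
  have "interior ?S \<inter> ?B = {} \<or> - ?S \<inter> ?B = {}"
    by (rule connectedD[OF conn open_interior open_Compl[OF S] disj cov])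
  moreover have "interior ?S \<inter> ?B \<noteq> {}"
  proof -
    obtain T where T: "T \<in> K" using K(2) by auto
    obtain y c where yc: "T = {z, y, c}" and D: "orient z y c > 0"
      using triangle_at_vertex[OF tri(1,2)[OF T]] by metis
    obtain w where w: "w \<in> ?B" "orient z y w > 0" "orient y c w > 0" "orient c z w > 0"
      using interior_point_near_vertex[OF D r(1)] by metis
    then have "w \<in> convex hull T" by (simp add: yc in_triangle_hull_iff[OF D])
    then have "w \<in> ?S" using T by blast
    then show ?thesis using key w(1) by blast
  qed
  ultimately have BS: "?B \<subseteq> ?S" by blast
  show ?thesis
  proof (intro equalityI K(1) subsetI)
    \<comment> \<open>Every triangle at \<open>z\<close> has interior points in the punctured disc;
      the member of \<open>K\<close> covering such a point can only be that triangle.\<close>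
    fix T assume "T \<in> {T\<in>Th. z \<in> T}"
    then have T: "T \<in> Th" "z \<in> T" by auto
    obtain y c where yc: "T = {z, y, c}" and D: "orient z y c > 0"
      using triangle_at_vertex[OF conforming_triangle[OF conf T(1)] T(2)] by metis
    obtain w where w: "w \<in> ?B" "orient z y w > 0" "orient y c w > 0" "orient c z w > 0"
      using interior_point_near_vertex[OF D r(1)] by metis
    then obtain T' where T': "T' \<in> K" "w \<in> convex hull T'" using BS by blast
    then have "T' = T" using triangle_interior_unique[OF conf T(1)[unfolded yc] tri(3)[OF T'(1)] w(2-4)] yc by simp
    then show "T \<in> K" using T' by simp
  qed
qed

text \<open>Adjacency requires a whole common edge \<open>{z, y}\<close>; triangles that meet only
  in \<open>z\<close> are not related, so the star can fall apart.\<close>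

definition vertex_adj :: "pt set set \<Rightarrow> pt \<Rightarrow> (pt set \<times> pt set) set" where
  "vertex_adj Th z = {(T, T'). T \<in> Th \<and> T' \<in> Th \<and> z \<in> T \<and> z \<in> T' \<and> (\<exists>y. y \<noteq> z \<and> y \<in> T \<and> y \<in> T')}"

text \<open>If no boundary edge can be reached, the class of \<open>T\<close> under adjacency
  satisfies the hypotheses of \<open>star_eq_of_adjacency_closed\<close> and is the whole
  star.\<close>

lemma star_connected_or_boundary:
  assumes conf: "conforming_triangulation \<Omega> Th" and "open \<Omega>" and T: "T \<in> Th" "z \<in> T" and T': "T' \<in> Th" "z \<in> T'"
  shows "(T, T') \<in> (vertex_adj Th z)\<^sup>* \<or>
    (\<exists>T1 y. (T, T1) \<in> (vertex_adj Th z)\<^sup>* \<and> T1 \<in> Th \<and> z \<in> T1 \<and> y \<in> T1 \<and> y \<noteq> z \<and> convex hull {z, y} \<subseteq> frontier \<Omega>)"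
proof (rule ccontr)
  assume neg: "\<not> ?thesis"
  let ?K = "{T1\<in>Th. z \<in> T1 \<and> (T, T1) \<in> (vertex_adj Th z)\<^sup>*}"
  have "?K = {T\<in>Th. z \<in> T}"
  proof (rule star_eq_of_adjacency_closed[OF conf \<open>open \<Omega>\<close>])
    show "?K \<noteq> {}" using T by blast
    fix T1 T2 y assume h: "T1 \<in> ?K" "T2 \<in> Th" "y \<noteq> z" "{z, y} \<subseteq> T1" "{z, y} \<subseteq> T2"
    then have "(T1, T2) \<in> vertex_adj Th z" by (auto simp: vertex_adj_def)
    with h show "T2 \<in> ?K" by (auto intro: rtrancl_into_rtrancl)
  qed (use neg in auto)
  then show False using neg T' by blast
qed

section \<open>Nodal interpolation\<close>

lemma affine_interpolant_ex:
  assumes "triangle T"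
  shows "\<exists>g k. \<forall>z\<in>T. f z = g \<bullet> z + k"
proof -
  obtain a b c where T: "T = {a, b, c}" and D: "orient a b c > 0"
    using triangle_oriented[OF assms] by metis
  let ?D = "orient a b c"
  define j where "j = 1 / ?D"
  define h where "h x = j * (f a * orient b c x + f b * orient c a x + f c * orient a b x)" for x
  have r: "orient b c a = ?D" "orient c a b = ?D" using orient_rotate by metis+
  have "h a = f a" "h b = f b" "h c = f c" using D by (simp_all add: h_def r j_def)
  moreover obtain g k where "\<And>x. h x = g \<bullet> x + k"
  proof
    fix x
    \<comment> \<open>\<open>h\<close> is affine, so its coefficients can be read off at the origin
      and the unit vectors.\<close>
    show "h x = (\<chi> i. h (axis i 1) - h 0) \<bullet> x + h 0"
      by (simp add: h_def orient_def inner_vec_def sum_2 axis_def algebra_simps)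
  qed
  ultimately show ?thesis using T by (intro exI[of _ g] exI[of _ k]) auto
qed

lemma affine_interpolant_unique:
  assumes "triangle T" "\<forall>z\<in>T. f z = g \<bullet> z + k" "\<forall>z\<in>T. f z = g' \<bullet> z + k'"
  shows "g = g' \<and> k = k'"
proof -
  have "g - g' = 0 \<and> k - k' = 0"
    by (rule affine_zero_on_triangle[OF assms(1)]) (use assms in \<open>auto simp: inner_diff_left\<close>)
  then show ?thesis by simp
qed

lemma aff_interp_eq:
  assumes "triangle T" "\<forall>z\<in>T. f z = g \<bullet> z + k"
  shows "aff_interp T f x = g \<bullet> x + k"
  unfolding aff_interp_def
  by (rule the_equality) (use assms affine_interpolant_unique[OF assms] in blast)+

text \<open>Well-definedness on overlaps: a point of two triangles lies in the hull of their common
  vertices, where the two affine interpolants agree at the vertices and therefore on the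
  hull.\<close>

lemma p1_interp_eq:
  assumes conf: "conforming_triangulation \<Omega> Th" and T: "T \<in> Th" "x \<in> convex hull T"
    and f: "\<forall>z\<in>T. f z = g \<bullet> z + k"
  shows "p1_interp Th f x = g \<bullet> x + k"
  unfolding p1_interp_def
proof (rule the_equality)
  have tri: "triangle T" using conforming_triangle[OF conf T(1)] .
  show "\<exists>T\<in>Th. x \<in> convex hull T \<and> g \<bullet> x + k = aff_interp T f x"
    using aff_interp_eq[OF tri f] T by metis
next
  fix v assume "\<exists>T\<in>Th. x \<in> convex hull T \<and> v = aff_interp T f x"
  then obtain T' where T': "T' \<in> Th" "x \<in> convex hull T'" "v = aff_interp T' f x" by blast
  have tri': "triangle T'" using conforming_triangle[OF conf T'(1)] .
  obtain g' k' where f': "\<forall>z\<in>T'. f z = g' \<bullet> z + k'" using affine_interpolant_ex[OF tri'] by blast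
  have v: "v = g' \<bullet> x + k'" using aff_interp_eq[OF tri' f'] T' by simp
  have "x \<in> convex hull (T \<inter> T')"
  proof (cases "T = T'")
    case False
    then show ?thesis using T T' conforming_hull_Int[OF conf T(1) T'(1)] by blast
  qed (use T in simp)
  moreover have "convex hull (T \<inter> T') \<subseteq> {x. (g - g') \<bullet> x = k' - k}"
    by (intro hull_minimal convex_hyperplane) (use f f' in \<open>auto simp: inner_diff_left algebra_simps\<close>)
  ultimately show "v = g \<bullet> x + k" using v by (auto simp: inner_diff_left)
qed

section \<open>Shape regularity\<close>

lemma dist_le_elem_diam:
  assumes "triangle T" "x \<in> convex hull T" "y \<in> convex hull T"
  shows "dist x y \<le> elem_diam T"
  unfolding elem_diam_def
  using assms compact_triangle by (intro diameter_bounded_bound compact_imp_bounded) auto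

lemma elem_diam_pos:
  assumes "triangle T" shows "elem_diam T > 0"
proof -
  obtain a b c where "T = {a, b, c}" "a \<noteq> b" using triangle_oriented[OF assms] by metis
  then have "dist a b \<le> elem_diam T" "dist a b > 0"
    using dist_le_elem_diam[OF assms, of a b] by (auto simp: hull_inc)
  then show ?thesis by linarith
qed

text \<open>The factor 2 makes the radius strictly smaller than \<open>inradius\<close>, which is a
  supremum whose attainment would otherwise have to be shown.\<close>

lemma inscribed_ball:
  assumes T: "triangle T" and \<sigma>: "\<sigma> > 0" "elem_diam T \<le> \<sigma> * inradius T"
  obtains x where "ball x (elem_diam T / (2 * \<sigma>)) \<subseteq> convex hull T"
proof -
  let ?X = "{r. r \<ge> 0 \<and> (\<exists>x. ball x r \<subseteq> convex hull T)}"
  have "elem_diam T / (2 * \<sigma>) < inradius T"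
    using \<sigma> elem_diam_pos[OF T] by (simp add: field_simps)
  moreover have "?X \<noteq> {}" by (auto intro!: exI[of _ 0])
  ultimately obtain r where "r \<in> ?X" "elem_diam T / (2 * \<sigma>) < r"
    unfolding inradius_def by (meson less_cSupE)
  then show thesis using that by (smt (verit) mem_Collect_eq subset_ball subset_trans)
qed

text \<open>The inscribed disc has radius r = h / (2 \<sigma>), and \<open>pi\<close> is estimated
  below by 2.\<close>

lemma area_lower:
  assumes T: "triangle T" and \<sigma>: "\<sigma> > 0" "elem_diam T \<le> \<sigma> * inradius T"
  shows "(elem_diam T)\<^sup>2 / (2 * \<sigma>\<^sup>2) \<le> area T"
proof -
  let ?r = "elem_diam T / (2 * \<sigma>)"
  obtain x where x: "ball x ?r \<subseteq> convex hull T" using inscribed_ball[OF assms] .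
  have r: "?r \<ge> 0" using elem_diam_pos[OF T] \<sigma> by simp
  have "(elem_diam T)\<^sup>2 / (2 * \<sigma>\<^sup>2) = 2 * ?r\<^sup>2" by (simp add: power_divide power_mult_distrib)
  also have "\<dots> \<le> pi * ?r\<^sup>2" by (intro mult_right_mono pi_ge_two) simp
  also have "\<dots> = measure lborel (ball x ?r)" using circle_area[OF r, of x] by simp
  also have "\<dots> \<le> area T"
    unfolding area_def
    by (rule measure_mono_fmeasurable) (use x T compact_triangle in \<open>auto intro: fmeasurable_compact\<close>)
  finally show ?thesis .
qed

lemma area_upper:
  assumes T: "triangle T"
  shows "area T \<le> 4 * (elem_diam T)\<^sup>2"
proof -
  let ?h = "elem_diam T"
  obtain a b c where abc: "T = {a, b, c}" using triangle_oriented[OF T] by metis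
  then have "convex hull T \<subseteq> cball a ?h"
    using dist_le_elem_diam[OF T, of a] by (auto simp: hull_inc)
  then have "area T \<le> measure lborel (cball a ?h)"
    unfolding area_def
    by (rule measure_mono_fmeasurable) (use T compact_triangle in \<open>auto simp: compact_imp_closed intro: fmeasurable_compact\<close>)
  also have "\<dots> = pi * ?h\<^sup>2" using elem_diam_pos[OF T] by (simp add: content_cball unit_ball_vol_2)
  also have "\<dots> \<le> 4 * ?h\<^sup>2" using pi_less_4 by (intro mult_right_mono) auto
  finally show ?thesis .
qed

text \<open>Twice the area is at most the edge length times the diameter, by Cauchy-Schwarz; the
  area itself is bounded below by \<open>area_lower\<close>.\<close>

lemma edge_length_lower:
  assumes T: "triangle T" and \<sigma>: "\<sigma> > 0" "elem_diam T \<le> \<sigma> * inradius T" and ab: "a \<in> T" "b \<in> T" "a \<noteq> b"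
  shows "elem_diam T / \<sigma>\<^sup>2 \<le> dist a b"
proof -
  let ?h = "elem_diam T"
  have h: "?h > 0" using elem_diam_pos[OF T] .
  have "card (T - {a, b}) = 1" using T ab by (simp add: triangle_def card_Diff_subset)
  then obtain c where "T - {a, b} = {c}" by (auto simp: card_1_singleton_iff)
  then have abc: "T = {a, b, c}" using ab by auto
  have "area T = \<bar>(c $ 1 - a $ 1) * (b $ 2 - a $ 2) - (b $ 1 - a $ 1) * (c $ 2 - a $ 2)\<bar> / 2"
    unfolding area_def abc by (rule content_triangle)
  also have "(c $ 1 - a $ 1) * (b $ 2 - a $ 2) - (b $ 1 - a $ 1) * (c $ 2 - a $ 2) = - (rot90 (b - a) \<bullet> (c - a))"
    by (simp add: rot90_inner)
  also have "\<bar>\<dots>\<bar> / 2 \<le> dist a b * ?h / 2"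
  proof -
    have "\<bar>rot90 (b - a) \<bullet> (c - a)\<bar> \<le> norm (b - a) * norm (c - a)"
      using Cauchy_Schwarz_ineq2[of "rot90 (b - a)" "c - a"] by simp
    also have "\<dots> \<le> norm (b - a) * ?h"
      using dist_le_elem_diam[OF T, of a c] by (intro mult_left_mono) (auto simp: abc hull_inc dist_norm norm_minus_commute)
    finally show ?thesis by (simp add: dist_norm norm_minus_commute)
  qed
  finally have "?h\<^sup>2 / (2 * \<sigma>\<^sup>2) \<le> dist a b * ?h / 2" using area_lower[OF T \<sigma>] by linarith
  then have "?h * (?h / \<sigma>\<^sup>2) \<le> ?h * dist a b" by (simp add: power2_eq_square field_simps)
  then show ?thesis using h by (simp only: mult_le_cancel_left_pos)
qed

text \<open>The bound at the vertices extends to the triangle by convexity, and the variation along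
  \<open>g\<close> inside the inscribed ball limits the gradient to 4 \<sigma> M / h. Multiplication
  by the area, at most 4 h^2, removes h and gives the factor 64.\<close>

lemma gradient_inverse_estimate:
  assumes T: "triangle T" and \<sigma>: "\<sigma> > 0" "elem_diam T \<le> \<sigma> * inradius T"
    and M: "\<And>z. z \<in> T \<Longrightarrow> \<bar>g \<bullet> z + k\<bar> \<le> M"
  shows "area T * (g \<bullet> g) \<le> 64 * \<sigma>\<^sup>2 * M\<^sup>2"
proof -
  let ?h = "elem_diam T"
  define r where "r = elem_diam T / (2 * \<sigma>)"
  have h: "?h > 0" using elem_diam_pos[OF T] .
  then have r: "r > 0" using \<sigma> by (simp add: r_def)
  obtain x where x: "ball x r \<subseteq> convex hull T" using inscribed_ball[OF T \<sigma>] unfolding r_def .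
  have hull: "convex hull T \<subseteq> {y. g \<bullet> y \<le> M - k} \<inter> {y. g \<bullet> y \<ge> - M - k}"
    by (intro hull_minimal convex_Int convex_halfspace_le convex_halfspace_ge) (use M in force)
  have "norm g * (r / 2) \<le> M"
  proof (cases "g = 0")
    case True
    obtain a where "a \<in> T" using triangle_oriented[OF T] by (metis insertI1)
    then have "0 \<le> M" using M[of a] by linarith
    then show ?thesis using True by simp
  next
    case False
    \<comment> \<open>Half the radius, because \<open>ball\<close> is open.\<close>
    let ?v = "(r / 2 / norm g) *\<^sub>R g"
    have nv: "norm ?v = r / 2" using False r by simp
    have "r / 2 < r" using r by simp
    with nv have "x + ?v \<in> ball x r" "x - ?v \<in> ball x r" by (simp_all only: mem_ball dist_norm) simp_all
    then have "g \<bullet> (x + ?v) \<le> M - k" "g \<bullet> (x - ?v) \<ge> - M - k" using x hull by blast+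
    moreover have "g \<bullet> ?v = norm g * (r / 2)"
      using False by (simp add: power2_norm_eq_inner[symmetric] power2_eq_square)
    ultimately show ?thesis unfolding inner_add_right inner_diff_right by linarith
  qed
  then have "norm g * ?h \<le> 4 * \<sigma> * M" using \<sigma> by (simp add: r_def field_simps)
  then have "(norm g * ?h)\<^sup>2 \<le> (4 * \<sigma> * M)\<^sup>2" using h by (intro power_mono) auto
  then have "?h\<^sup>2 * (g \<bullet> g) \<le> 16 * \<sigma>\<^sup>2 * M\<^sup>2" by (simp add: power_mult_distrib power2_norm_eq_inner mult.commute)
  moreover have "area T * (g \<bullet> g) \<le> 4 * ?h\<^sup>2 * (g \<bullet> g)"
    using area_upper[OF T] by (intro mult_right_mono) auto
  ultimately show ?thesis by linarith
qed

text \<open>By conformity two different triangles meet in the hull of at most two points, a null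
  set, so areas are additive. It serves both to count triangles at a vertex and to compare fine
  triangles with their parent.\<close>

lemma sum_area_le:
  assumes conf: "conforming_triangulation \<Omega> Th" and F: "F \<subseteq> Th" "\<And>T. T \<in> F \<Longrightarrow> convex hull T \<subseteq> S" and S: "compact S"
  shows "(\<Sum>T\<in>F. area T) \<le> measure lborel S"
proof -
  have fin: "finite F" using conf F(1) finite_subset by (metis conforming_triangulation_def)
  have tri: "triangle T" if "T \<in> F" for T using conforming_triangle[OF conf] F that by auto
  have lm: "convex hull T \<in> lmeasurable" if "T \<in> F" for T
    using compact_triangle[OF tri[OF that]] by (rule lmeasurable_compact)
  have eq: "measure lebesgue K = measure lborel K" if "compact K" for K :: "pt set"
    using that by (simp add: compact_imp_closed borel_closed)
  have neg: "negligible (convex hull T \<inter> convex hull T')" if "T \<in> F" "T' \<in> F" "T \<noteq> T'" for T T'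
  proof -
    have c: "card T = 3" "card T' = 3" using tri that by (auto simp: triangle_def)
    then have "\<not> T \<subseteq> T'" using that by (metis card_subset_eq card.infinite zero_neq_numeral)
    moreover have "finite T" using c by (simp add: card_ge_0_finite)
    ultimately have "card (T \<inter> T') < 3" using c by (metis Int_lower1 inf.orderI psubsetI psubset_card_mono)
    then have "aff_dim (convex hull (T \<inter> T')) \<noteq> int DIM(pt)"
      using aff_dim_le_card[of "T \<inter> T'"] \<open>finite T\<close> by (simp add: aff_dim_convex_hull)
    then have "negligible (convex hull (T \<inter> T'))"
      using low_dim_interior negligible_convex_interior convex_convex_hull by blast
    moreover have "T \<in> Th" "T' \<in> Th" using F(1) that by auto
    ultimately show ?thesis using conforming_hull_Int[OF conf _ _ that(3)] by simp
  qed
  have "(\<Sum>T\<in>F. area T) = (\<Sum>T\<in>F. measure lebesgue (convex hull T))"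
    unfolding area_def using eq compact_triangle tri by (intro sum.cong) auto
  also have "\<dots> = measure lebesgue (\<Union>T\<in>F. convex hull T)"
    by (rule measure_negligible_finite_Union_image[symmetric]) (use fin lm neg in \<open>auto simp: pairwise_def\<close>)
  also have "\<dots> \<le> measure lebesgue S"
    by (rule measure_mono_fmeasurable) (use fin lm F S in \<open>auto intro!: sets.finite_UN intro: lmeasurable_compact fmeasurableD\<close>)
  finally show ?thesis using eq[OF S] by simp
qed

lemma elem_diam_le_mesh_size:
  "conforming_triangulation \<Omega> Th \<Longrightarrow> T \<in> Th \<Longrightarrow> elem_diam T \<le> mesh_size Th"
  by (simp add: mesh_size_def conforming_triangulation_def)

lemma mesh_size_pos:
  assumes "conforming_triangulation \<Omega> Th" shows "mesh_size Th > 0"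
proof -
  obtain T where "T \<in> Th" using assms by (auto simp: conforming_triangulation_def)
  then show ?thesis
    using elem_diam_pos[OF conforming_triangle[OF assms]] elem_diam_le_mesh_size[OF assms] by (meson less_le_trans)
qed

text \<open>A packing argument: with mesh size H, all triangles at \<open>z\<close> lie in a disc of
  radius H, of area at most 4 H^2, and each has area at least H^2 / (2 \<sigma>^2
  \<kappa>^2).\<close>

lemma card_star_le:
  assumes conf: "conforming_triangulation \<Omega> Th" and reg: "shape_regular \<sigma> Th" "quasi_uniform \<kappa> Th"
    and pos: "\<sigma> > 0" "\<kappa> > 0"
  shows "real (card {T\<in>Th. z \<in> T}) \<le> 8 * \<sigma>\<^sup>2 * \<kappa>\<^sup>2"
proof -
  let ?H = "mesh_size Th" and ?F = "{T\<in>Th. z \<in> T}"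
  have H: "?H > 0" using mesh_size_pos[OF conf] .
  have tri: "triangle T" if "T \<in> Th" for T using conforming_triangle[OF conf that] .
  have lo: "?H\<^sup>2 / (2 * \<sigma>\<^sup>2 * \<kappa>\<^sup>2) \<le> area T" if "T \<in> ?F" for T
  proof -
    have "?H \<le> \<kappa> * elem_diam T" using reg that by (auto simp: quasi_uniform_def)
    then have "?H\<^sup>2 \<le> (\<kappa> * elem_diam T)\<^sup>2" using H by (intro power_mono) auto
    then have "?H\<^sup>2 / (2 * \<sigma>\<^sup>2 * \<kappa>\<^sup>2) \<le> (\<kappa> * elem_diam T)\<^sup>2 / (2 * \<sigma>\<^sup>2 * \<kappa>\<^sup>2)" by (intro divide_right_mono) auto
    also have "\<dots> = (elem_diam T)\<^sup>2 / (2 * \<sigma>\<^sup>2)" using pos by (simp add: power_mult_distrib)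
    also have "\<dots> \<le> area T" using area_lower tri pos reg that by (auto simp: shape_regular_def)
    finally show ?thesis .
  qed
  have "real (card ?F) * (?H\<^sup>2 / (2 * \<sigma>\<^sup>2 * \<kappa>\<^sup>2)) \<le> (\<Sum>T\<in>?F. area T)"
    using sum_bounded_below[of ?F "?H\<^sup>2 / (2 * \<sigma>\<^sup>2 * \<kappa>\<^sup>2)" area] lo by (simp only:)
  also have "\<dots> \<le> measure lborel (cball z ?H)"
  proof (rule sum_area_le[OF conf])
    fix T assume "T \<in> ?F"
    then show "convex hull T \<subseteq> cball z ?H"
      using dist_le_elem_diam[OF tri, of T z] elem_diam_le_mesh_size[OF conf, of T]
      by (fastforce simp: hull_inc)
  qed auto
  also have "\<dots> = pi * ?H\<^sup>2" using H by (simp add: content_cball unit_ball_vol_2)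
  also have "\<dots> \<le> 4 * ?H\<^sup>2" using pi_less_4 by (intro mult_right_mono) auto
  finally show ?thesis using H pos by (simp add: field_simps)
qed

section \<open>Energy estimates on one element\<close>

definition local_energy :: "real \<Rightarrow> pt set \<Rightarrow> (pt set \<Rightarrow> pt \<Rightarrow> real) \<Rightarrow> real" where
  "local_energy \<tau> T m = elem_int T (\<lambda>x. lsQ \<tau> T m x \<bullet> lsQ \<tau> T m x)
     + \<tau> * bdry_int T (\<lambda>e x. (lsU \<tau> T m x - m e x) * (lsU \<tau> T m x - m e x))"

lemma ahat_diag: "ahat \<tau> Th m m = (\<Sum>T\<in>Th. local_energy \<tau> T m)"
  by (simp add: ahat_def local_energy_def)

text \<open>No compatibility between the edges is imposed: traces may jump at the vertices, which is
  why the interpolation has to average.\<close>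

definition edgewise_affine :: "pt set \<Rightarrow> (pt set \<Rightarrow> pt \<Rightarrow> real) \<Rightarrow> bool" where
  "edgewise_affine T m \<longleftrightarrow> (\<forall>e\<in>tri_edges T. \<exists>a c. \<forall>x\<in>convex hull e. m e x = a \<bullet> x + c)"

lemma edgewise_affine_continuous:
  assumes "edgewise_affine T m" "e \<in> tri_edges T"
  shows "continuous_on (convex hull e) (m e)"
proof -
  obtain a c where "\<forall>x\<in>convex hull e. m e x = a \<bullet> x + c" using assms unfolding edgewise_affine_def by blast
  moreover have "continuous_on (convex hull e) (\<lambda>x. a \<bullet> x + c)" by (intro continuous_intros)
  ultimately show ?thesis by (simp cong: continuous_on_cong)
qed

lemma edge_int_nonneg:
  assumes "\<And>x. 0 \<le> f x" shows "0 \<le> edge_int e f"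
proof -
  have "0 \<le> (LINT t : {0..1} | lborel. f ((1 - t) *\<^sub>R a + t *\<^sub>R b))" for a b :: pt
    unfolding set_lebesgue_integral_def
    by (intro Bochner_Integration.integral_nonneg) (auto simp: assms)
  then show ?thesis by (auto simp: edge_int_def split: prod.split)
qed

lemma bdry_int_nonneg: "(\<And>e x. 0 \<le> f e x) \<Longrightarrow> 0 \<le> bdry_int T f"
  unfolding bdry_int_def by (intro sum_nonneg edge_int_nonneg) auto

lemma local_energy_nonneg:
  assumes "\<tau> > 0" shows "0 \<le> local_energy \<tau> T m"
proof -
  have "0 \<le> elem_int T (\<lambda>x. lsQ \<tau> T m x \<bullet> lsQ \<tau> T m x)" by (rule elem_int_nonneg) simp
  moreover have "0 \<le> bdry_int T (\<lambda>e x. (lsU \<tau> T m x - m e x) * (lsU \<tau> T m x - m e x))"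
    by (rule bdry_int_nonneg) simp
  ultimately show ?thesis using assms by (simp add: local_energy_def)
qed

lemma norm_outer_normal_le: "norm (outer_normal T e) \<le> 1"
  by (simp add: outer_normal_def Let_def split: prod.split)

lemma bdry_int_const_le:
  assumes T: "triangle T" and "k \<ge> 0"
  shows "bdry_int T (\<lambda>e x. k) \<le> 3 * elem_diam T * k"
proof -
  obtain a b c where abc: "T = {a, b, c}" and D: "orient a b c > 0" and ne: "a \<noteq> b" "a \<noteq> c" "b \<noteq> c"
    using triangle_oriented[OF T] by metis
  have "dist a b \<le> elem_diam T" "dist b c \<le> elem_diam T" "dist c a \<le> elem_diam T"
    using dist_le_elem_diam[OF T] by (auto simp: abc hull_inc)
  then have "dist a b * k \<le> elem_diam T * k" "dist b c * k \<le> elem_diam T * k" "dist c a * k \<le> elem_diam T * k"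
    using \<open>k \<ge> 0\<close> by (auto intro: mult_right_mono)
  then show ?thesis
    unfolding abc bdry_int_eq[OF D] edge_int_const[OF ne(1)] edge_int_const[OF ne(3)] edge_int_const[OF ne(2)[symmetric]]
    unfolding abc[symmetric] by linarith
qed

text \<open>The constant field \<open>g\<close> has no divergence, so the first local equation
  contains only \<open>m\<close>. Subtracting it from the divergence theorem for U expresses |T|
  |g|^2 by the field Q and the jump U - m, both of which the energy controls.\<close>

lemma grad_energy_estimate:
  assumes T: "triangle T" and \<sigma>: "\<sigma> > 0" "elem_diam T \<le> \<sigma> * inradius T"
    and \<tau>: "\<tau> > 0" "\<gamma> > 0" "\<gamma> \<le> \<tau> * elem_diam T" and m: "edgewise_affine T m"
    and U: "lsU \<tau> T m = (\<lambda>x. g \<bullet> x + k)"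
  shows "area T * (g \<bullet> g) \<le> (2 + 12 * \<sigma>\<^sup>2 / \<gamma>) * local_energy \<tau> T m"
proof -
  let ?h = "elem_diam T" and ?Q = "lsQ \<tau> T m" and ?n = "outer_normal T"
  have cm: "\<And>e. e \<in> tri_edges T \<Longrightarrow> continuous_on (convex hull e) (m e)"
    using edgewise_affine_continuous[OF m] .
  have eqs: "local_eqs \<tau> T m ?Q (\<lambda>x. g \<bullet> x + k)"
    using local_solver_eqs[OF T \<tau>(1), of m] cm U by simp
  then obtain A u where Q: "?Q = (\<lambda>x. A *v x + u)" unfolding local_eqs_def using P1vec_param by blast
  have cQ: "continuous_on S ?Q" for S
    unfolding Q by (intro continuous_intros linear_continuous_on matrix_vector_mul_bounded_linear)
  define EQ where "EQ = elem_int T (\<lambda>x. ?Q x \<bullet> ?Q x)"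
  define B where "B = bdry_int T (\<lambda>e x. (g \<bullet> x + k - m e x) * (g \<bullet> x + k - m e x))"
  have E: "local_energy \<tau> T m = EQ + \<tau> * B" by (simp add: local_energy_def EQ_def B_def U)
  have EQ0: "EQ \<ge> 0" unfolding EQ_def by (rule elem_int_nonneg) simp
  have B0: "B \<ge> 0" unfolding B_def by (rule bdry_int_nonneg) simp
  have h: "?h > 0" using elem_diam_pos[OF T] .
  have lo: "?h\<^sup>2 / (2 * \<sigma>\<^sup>2) \<le> area T" using area_lower[OF T \<sigma>] .
  have ar: "area T > 0" using lo h \<sigma> by (smt (verit) divide_pos_pos zero_less_power mult_pos_pos)
  have z0: "elem_int T (\<lambda>x. 0) = 0" using elem_int_const[OF T, of 0] by simp
  have tr0: "trace (0 :: real^2^2) = 0" by (simp add: trace_def)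
  have "elem_int T (\<lambda>x. ?Q x \<bullet> g) = - bdry_int T (\<lambda>e x. m e x * (g \<bullet> ?n e))"
  proof -
    have "(\<lambda>x. g) \<in> P1vec" using P1vecI[of 0 g] by simp
    moreover have "vdiv (\<lambda>x. g) x = 0" for x using vdiv_affine[of 0 g x] by (simp add: tr0)
    ultimately show ?thesis using eqs z0 unfolding local_eqs_def by fastforce
  qed
  moreover have "area T * (g \<bullet> g) = bdry_int T (\<lambda>e x. (g \<bullet> x + k) * (g \<bullet> ?n e))"
    using divergence_theorem_triangle[OF T, of 0 g g k] by (simp add: tr0 z0 elem_int_const[OF T])
  moreover have "bdry_int T (\<lambda>e x. (g \<bullet> x + k) * (g \<bullet> ?n e) + (- 1) * (m e x * (g \<bullet> ?n e)))
      = bdry_int T (\<lambda>e x. (g \<bullet> x + k) * (g \<bullet> ?n e)) + bdry_int T (\<lambda>e x. (- 1) * (m e x * (g \<bullet> ?n e)))"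
    by (intro bdry_int_add continuous_intros cm; assumption)
  moreover have "bdry_int T (\<lambda>e x. (- 1) * (m e x * (g \<bullet> ?n e))) = - bdry_int T (\<lambda>e x. m e x * (g \<bullet> ?n e))"
    unfolding bdry_int_cmult by simp
  ultimately have main: "area T * (g \<bullet> g) = - elem_int T (\<lambda>x. ?Q x \<bullet> g)
      + bdry_int T (\<lambda>e x. (g \<bullet> x + k - m e x) * (g \<bullet> ?n e))"
    by (simp add: left_diff_distrib)
  have "- elem_int T (\<lambda>x. ?Q x \<bullet> g) = elem_int T (\<lambda>x. (- 1) * (?Q x \<bullet> g))" by (subst elem_int_cmult) simp
  also have "\<dots> \<le> elem_int T (\<lambda>x. ?Q x \<bullet> ?Q x + (g \<bullet> g) / 4)"
  proof (intro elem_int_mono T continuous_intros cQ)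
    fix x
    have "0 \<le> (?Q x + (1/2) *\<^sub>R g) \<bullet> (?Q x + (1/2) *\<^sub>R g)" by simp
    then show "- 1 * (?Q x \<bullet> g) \<le> ?Q x \<bullet> ?Q x + (g \<bullet> g) / 4"
      by (simp add: inner_add_left inner_add_right inner_commute)
  qed
  also have "\<dots> = EQ + elem_int T (\<lambda>x. (g \<bullet> g) / 4)"
    unfolding EQ_def by (intro elem_int_add T continuous_intros cQ)
  finally have 1: "- elem_int T (\<lambda>x. ?Q x \<bullet> g) \<le> EQ + area T * (g \<bullet> g) / 4"
    by (simp add: elem_int_const[OF T])
  \<comment> \<open>Young's inequality with a weight chosen so that the gradient terms add up to half of the left-hand side.\<close>
  define K where "K = 3 * ?h / area T"
  have K: "K > 0" using h ar by (simp add: K_def)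
  have "bdry_int T (\<lambda>e x. (g \<bullet> x + k - m e x) * (g \<bullet> ?n e))
      \<le> bdry_int T (\<lambda>e x. K * ((g \<bullet> x + k - m e x) * (g \<bullet> x + k - m e x)) + (g \<bullet> g) / (4 * K))"
  proof (intro bdry_int_mono continuous_intros cm)
    fix e x
    let ?s = "g \<bullet> x + k - m e x" and ?t = "g \<bullet> ?n e"
    have "\<bar>?t\<bar> \<le> norm g * norm (?n e)" by (rule Cauchy_Schwarz_ineq2)
    also have "\<dots> \<le> norm g" using norm_outer_normal_le[of T e] by (simp add: mult_left_le)
    finally have "?t\<^sup>2 \<le> (norm g)\<^sup>2" by (metis abs_ge_zero power2_abs power_mono)
    then have "?t\<^sup>2 / (4 * K) \<le> (g \<bullet> g) / (4 * K)" using K by (simp add: power2_norm_eq_inner divide_right_mono)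
    moreover have "?s * ?t \<le> K * (?s * ?s) + ?t\<^sup>2 / (4 * K)"
    proof -
      have "0 \<le> K * (?s - ?t / (2 * K))\<^sup>2" using K by simp
      also have "\<dots> = K * (?s * ?s) - ?s * ?t + ?t\<^sup>2 / (4 * K)"
        using K by (simp add: power2_eq_square field_simps)
      finally show ?thesis by linarith
    qed
    ultimately show "?s * ?t \<le> K * (?s * ?s) + (g \<bullet> g) / (4 * K)" by linarith
  qed (assumption | use K in simp)+
  also have "\<dots> = bdry_int T (\<lambda>e x. K * ((g \<bullet> x + k - m e x) * (g \<bullet> x + k - m e x))) + bdry_int T (\<lambda>e x. (g \<bullet> g) / (4 * K))"
    using K by (intro bdry_int_add continuous_intros cm; simp)
  also have "bdry_int T (\<lambda>e x. K * ((g \<bullet> x + k - m e x) * (g \<bullet> x + k - m e x))) = K * B"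
    unfolding B_def by (rule bdry_int_cmult)
  also have "bdry_int T (\<lambda>e x. (g \<bullet> g) / (4 * K)) \<le> 3 * ?h * ((g \<bullet> g) / (4 * K))"
    using K by (intro bdry_int_const_le T) simp
  also have "3 * ?h * ((g \<bullet> g) / (4 * K)) = area T * (g \<bullet> g) / 4"
    using ar h by (simp add: K_def)
  finally have "area T * (g \<bullet> g) \<le> 2 * EQ + 2 * (K * B)" using 1 main by linarith
  \<comment> \<open>\<open>area_lower\<close> bounds \<open>K\<close> by a multiple of 1/h, and 1/h
    is at most \<tau> / \<gamma>: here the scaling of the stabilization enters.\<close>
  also have "K * B \<le> 6 * \<sigma>\<^sup>2 / \<gamma> * (\<tau> * B)"
  proof -
    have "3 * ?h \<le> 6 * \<sigma>\<^sup>2 / ?h * (?h\<^sup>2 / (2 * \<sigma>\<^sup>2))" using h \<sigma> by (simp add: power2_eq_square)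
    also have "\<dots> \<le> 6 * \<sigma>\<^sup>2 / ?h * area T" using lo h by (intro mult_left_mono) auto
    finally have "K \<le> 6 * \<sigma>\<^sup>2 / ?h" using ar by (simp add: K_def field_simps)
    also have "\<dots> \<le> 6 * \<sigma>\<^sup>2 / \<gamma> * \<tau>"
    proof -
      have "1 / ?h \<le> \<tau> / \<gamma>" using h \<tau> by (simp add: field_simps)
      then have "6 * \<sigma>\<^sup>2 * (1 / ?h) \<le> 6 * \<sigma>\<^sup>2 * (\<tau> / \<gamma>)" by (intro mult_left_mono) auto
      then show ?thesis by simp
    qed
    finally show ?thesis using B0 by (metis mult.assoc mult_right_mono)
  qed
  finally have "area T * (g \<bullet> g) \<le> 2 * EQ + 12 * \<sigma>\<^sup>2 / \<gamma> * (\<tau> * B)" by simp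
  also have "\<dots> \<le> (2 + 12 * \<sigma>\<^sup>2 / \<gamma>) * (EQ + \<tau> * B)"
  proof -
    have "0 \<le> 12 * \<sigma>\<^sup>2 / \<gamma> * EQ" "0 \<le> \<tau> * B" using EQ0 B0 \<tau> by simp_all
    then show ?thesis by (simp add: distrib_left distrib_right)
  qed
  finally show ?thesis unfolding E .
qed

text \<open>The jump is linear on \<open>e\<close>, so its squared integral is at least the edge
  length times p^2 / 6, where p is its value at \<open>z\<close>. The edge length is at least h /
  \<sigma>^2, and \<tau> h is at least \<gamma>.\<close>

lemma vertex_energy_estimate:
  assumes T: "triangle T" and \<sigma>: "\<sigma> > 0" "elem_diam T \<le> \<sigma> * inradius T"
    and \<tau>: "\<tau> > 0" "\<gamma> > 0" "\<gamma> \<le> \<tau> * elem_diam T" and m: "edgewise_affine T m"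
    and e: "e \<in> tri_edges T" "z \<in> e"
  shows "(lsU \<tau> T m z - m e z)\<^sup>2 \<le> 6 * \<sigma>\<^sup>2 / \<gamma> * local_energy \<tau> T m"
proof -
  let ?h = "elem_diam T" and ?f = "\<lambda>e x. lsU \<tau> T m x - m e x"
  have h: "?h > 0" using elem_diam_pos[OF T] .
  have "lsU \<tau> T m \<in> P1"
    using local_solver_eqs[OF T \<tau>(1), of m] edgewise_affine_continuous[OF m] by (simp add: local_eqs_def)
  then obtain g k where U: "lsU \<tau> T m = (\<lambda>x. g \<bullet> x + k)" by (rule P1_param)
  obtain a c where ac: "\<forall>x\<in>convex hull e. m e x = a \<bullet> x + c" using m e(1) unfolding edgewise_affine_def by blast
  obtain y where y: "e = {z, y}" "z \<noteq> y" "y \<in> T" "z \<in> T"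
    using e by (auto simp: tri_edges_def card_2_iff)
  let ?p = "?f e z" and ?q = "?f e y"
  have lin: "?f e ((1 - t) *\<^sub>R z + t *\<^sub>R y) = (1 - t) * ?p + t * ?q" if "t \<in> {0..1}" for t
  proof -
    have "(1 - t) *\<^sub>R z + t *\<^sub>R y \<in> convex hull e" "z \<in> convex hull e" "y \<in> convex hull e"
      using edge_param_in_hull[OF that] y by (auto simp: hull_inc)
    then show ?thesis using ac unfolding U by (simp add: algebra_simps)
  qed
  have sq: "p\<^sup>2 / 6 \<le> (2 * p * p + p * q + q * p + 2 * q * q) / 6" for p q :: real
    using sum_squares_ge_zero[of "p + q" q] by (simp add: power2_eq_square algebra_simps)
  have eq: "edge_int e (\<lambda>x. ?f e x * ?f e x) = dist z y * ((2 * ?p * ?p + ?p * ?q + ?q * ?p + 2 * ?q * ?q) / 6)"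
    unfolding y(1) by (rule edge_int_affine_mult[OF y(2)]) (use lin in \<open>simp_all add: y(1)\<close>)
  have "?h / \<sigma>\<^sup>2 * (?p\<^sup>2 / 6) \<le> edge_int e (\<lambda>x. ?f e x * ?f e x)"
    unfolding eq by (intro mult_mono edge_length_lower[OF T \<sigma> y(4,3,2)] sq) auto
  also have "\<dots> \<le> bdry_int T (\<lambda>e x. ?f e x * ?f e x)"
    unfolding bdry_int_def
    by (rule member_le_sum[of e _ "\<lambda>e. edge_int e (\<lambda>x. ?f e x * ?f e x)"])
      (use e finite_tri_edges[OF T] in \<open>auto intro: edge_int_nonneg\<close>)
  finally have "\<tau> * (?h / \<sigma>\<^sup>2 * (?p\<^sup>2 / 6)) \<le> \<tau> * bdry_int T (\<lambda>e x. ?f e x * ?f e x)"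
    using \<tau> by (intro mult_left_mono) auto
  also have "\<dots> \<le> local_energy \<tau> T m"
    using elem_int_nonneg[of T "\<lambda>x. lsQ \<tau> T m x \<bullet> lsQ \<tau> T m x"] by (simp add: local_energy_def)
  finally have 2: "\<tau> * ?h * (?p\<^sup>2 / (6 * \<sigma>\<^sup>2)) \<le> local_energy \<tau> T m" by simp
  have "\<gamma> * (?p\<^sup>2 / (6 * \<sigma>\<^sup>2)) \<le> \<tau> * ?h * (?p\<^sup>2 / (6 * \<sigma>\<^sup>2))"
    using \<tau> by (intro mult_right_mono) auto
  then have "\<gamma> * (?p\<^sup>2 / (6 * \<sigma>\<^sup>2)) \<le> local_energy \<tau> T m" using 2 by linarith
  then show ?thesis using \<tau> \<sigma> by (simp add: field_simps)
qed

section \<open>Averaging at a vertex\<close>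

text \<open>Here \<open>u T\<close> stands for the value at \<open>z\<close> of the local solution
  on \<open>T\<close> and \<open>v e\<close> for the trace at \<open>z\<close>. Two triangles are
  compared along a chain of common edges or, if they lie in different components of the star, both
  with zero at the boundary.\<close>

lemma nodal_average_close:
  assumes conf: "conforming_triangulation \<Omega> Th" and "open \<Omega>"
    and close: "\<And>T e. T \<in> Th \<Longrightarrow> e \<in> tri_edges T \<Longrightarrow> z \<in> e \<Longrightarrow> \<bar>u T - v e\<bar> \<le> \<delta>"
    and bdry: "\<And>e. e \<in> edges Th \<Longrightarrow> z \<in> e \<Longrightarrow> convex hull e \<subseteq> frontier \<Omega> \<Longrightarrow> v e = 0"
    and N: "real (card {T\<in>Th. z \<in> T}) \<le> N" and T: "T \<in> Th" "z \<in> T"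
  shows "\<bar>(\<Sum>e\<in>edges_at Th z. v e) / real (card (edges_at Th z)) - u T\<bar> \<le> (4 * N\<^sup>2 + 3) * \<delta>"
proof -
  let ?S = "{T\<in>Th. z \<in> T}" and ?R = "vertex_adj Th z"
  have fin: "finite Th" using conf by (simp add: conforming_triangulation_def)
  have edge: "{z, y} \<in> tri_edges T" if "z \<in> T" "y \<in> T" "y \<noteq> z" for y T
    using that by (auto simp: tri_edges_def)
  obtain y where y: "y \<in> T" "y \<noteq> z"
    using triangle_at_vertex[OF conforming_triangle[OF conf T(1)] T(2)] by (metis insertCI)
  then have \<delta>: "\<delta> \<ge> 0" using close[OF T(1) edge[OF T(2)]] by force
  have R: "?R \<subseteq> ?S \<times> ?S" by (auto simp: vertex_adj_def)
  then have finR: "finite ?R" using fin by (auto intro: finite_subset)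
  have "card ?R \<le> card ?S * card ?S" using card_mono[OF _ R] fin by (simp add: card_cartesian_product)
  then have "real (card ?R) \<le> real (card ?S) * real (card ?S)" by (simp only: of_nat_mult[symmetric] of_nat_le_iff)
  also have "\<dots> \<le> N * N" using N by (intro mult_mono) auto
  finally have cardR: "real (card ?R) \<le> N\<^sup>2" by (simp add: power2_eq_square)
  have step: "\<bar>u T1 - u T2\<bar> \<le> 2 * \<delta>" if "(T1, T2) \<in> ?R" for T1 T2
  proof -
    obtain y where "y \<noteq> z" "y \<in> T1" "y \<in> T2" "T1 \<in> Th" "T2 \<in> Th" "z \<in> T1" "z \<in> T2"
      using \<open>(T1, T2) \<in> ?R\<close> by (auto simp: vertex_adj_def)
    then have "\<bar>u T1 - v {z, y}\<bar> \<le> \<delta>" "\<bar>u T2 - v {z, y}\<bar> \<le> \<delta>" using close edge by auto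
    then show ?thesis by linarith
  qed
  have path: "\<bar>u T1 - u T2\<bar> \<le> 2 * real n * \<delta>" if "(T1, T2) \<in> ?R ^^ n" for T1 T2 n
    using that
  proof (induction n arbitrary: T2)
    case (Suc n)
    then obtain T3 where "(T1, T3) \<in> ?R ^^ n" "(T3, T2) \<in> ?R" by auto
    then have "\<bar>u T1 - u T3\<bar> \<le> 2 * real n * \<delta>" "\<bar>u T3 - u T2\<bar> \<le> 2 * \<delta>" using Suc.IH step by auto
    then show ?case by (simp add: distrib_right distrib_left)
  qed auto
  have conn: "\<bar>u T1 - u T2\<bar> \<le> 2 * N\<^sup>2 * \<delta>" if chain: "(T1, T2) \<in> ?R\<^sup>*" for T1 T2
  proof -
    \<comment> \<open>A chain in a finite relation can be shortened to at most as many steps as the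
      relation has pairs, here at most \<open>N\<^sup>2\<close>.\<close>
    obtain n where n: "n \<le> card ?R" "(T1, T2) \<in> ?R ^^ n"
      using chain unfolding rtrancl_finite_eq_relpow[OF finR] by auto
    have "real n \<le> N\<^sup>2" using n(1) cardR by linarith
    then have "2 * real n * \<delta> \<le> 2 * N\<^sup>2 * \<delta>" using \<delta> by (intro mult_right_mono) auto
    then show ?thesis using path[OF n(2)] by linarith
  qed
  have far: "\<bar>u T1\<bar> \<le> 2 * N\<^sup>2 * \<delta> + \<delta>"
    if "(T1, T2) \<in> ?R\<^sup>*" "T2 \<in> Th" "z \<in> T2" "y \<in> T2" "y \<noteq> z" "convex hull {z, y} \<subseteq> frontier \<Omega>" for T1 T2 y
  proof -
    have e: "{z, y} \<in> tri_edges T2" using edge that by auto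
    then have "{z, y} \<in> edges Th" using that by (auto simp: edges_def)
    then have "v {z, y} = 0" using bdry that by auto
    then have "\<bar>u T2\<bar> \<le> \<delta>" using close[OF that(2) e] by simp
    then show ?thesis using conn[OF that(1)] by linarith
  qed
  have half: "\<bar>u T1 - u T2\<bar> \<le> 2 * N\<^sup>2 * \<delta> \<or> \<bar>u T1\<bar> \<le> 2 * N\<^sup>2 * \<delta> + \<delta>"
    if "T1 \<in> ?S" "T2 \<in> ?S" for T1 T2
    using star_connected_or_boundary[OF conf \<open>open \<Omega>\<close>, of T1 z T2] that conn far by blast
  \<comment> \<open>\<open>half\<close> is used in both orders: without a connecting chain both
    values are within (2 N^2 + 1) \<delta> of zero, and the two bounds add up to the
    constant.\<close>
  have all: "\<bar>u T1 - u T2\<bar> \<le> (4 * N\<^sup>2 + 2) * \<delta>" if "T1 \<in> ?S" "T2 \<in> ?S" for T1 T2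
  proof -
    have "0 \<le> N\<^sup>2 * \<delta>" using \<delta> by simp
    then have "\<bar>u T1 - u T2\<bar> \<le> 4 * (N\<^sup>2 * \<delta>) + 2 * \<delta>"
      using half[OF that] half[OF that(2,1)] \<delta> by linarith
    then show ?thesis by (simp add: algebra_simps)
  qed
  \<comment> \<open>One more \<delta> leads from the triangle containing \<open>e\<close> to the
    trace on \<open>e\<close>.\<close>
  have e: "\<bar>v e - u T\<bar> \<le> (4 * N\<^sup>2 + 3) * \<delta>" if at: "e \<in> edges_at Th z" for e
  proof -
    obtain T1 where T1: "T1 \<in> Th" "e \<in> tri_edges T1" "z \<in> e" using at by (auto simp: edges_at_def edges_def)
    then have "z \<in> T1" by (auto simp: tri_edges_def)
    then have "\<bar>u T1 - u T\<bar> \<le> (4 * N\<^sup>2 + 2) * \<delta>" using all T T1 by simp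
    moreover have "\<bar>u T1 - v e\<bar> \<le> \<delta>" using close T1 by simp
    moreover have "(4 * N\<^sup>2 + 3) * \<delta> = (4 * N\<^sup>2 + 2) * \<delta> + \<delta>" by (simp add: algebra_simps)
    ultimately show ?thesis by linarith
  qed
  let ?A = "edges_at Th z"
  have "finite (edges Th)"
    unfolding edges_def using fin finite_tri_edges conforming_triangle[OF conf] by auto
  then have finA: "finite ?A" by (simp add: edges_at_def)
  have "{z, y} \<in> ?A" using edge[OF T(2) y] T by (auto simp: edges_at_def edges_def)
  then have cA: "real (card ?A) > 0" using finA by (auto simp: card_gt_0_iff)
  have "(\<Sum>e\<in>?A. v e) / real (card ?A) - u T = (\<Sum>e\<in>?A. v e - u T) / real (card ?A)"
    using cA by (simp add: sum_subtractf diff_divide_distrib)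
  moreover have "\<bar>\<Sum>e\<in>?A. v e - u T\<bar> \<le> (\<Sum>e\<in>?A. (4 * N\<^sup>2 + 3) * \<delta>)"
    using e by (intro order_trans[OF sum_abs] sum_mono) auto
  ultimately show ?thesis using cA by (simp add: field_simps)
qed

section \<open>The two levels\<close>

lemma M0space_edgewise_affine: "mu \<in> M0space \<Omega> Th \<Longrightarrow> T \<in> Th \<Longrightarrow> edgewise_affine T mu"
  unfolding M0space_def Mspace_def edgewise_affine_def edges_def by blast

text \<open>Double counting: \<open>E T'\<close> occurs once for each of its three vertices and each
  of the at most N triangles at that vertex.\<close>

lemma sum_vertex_patches_le:
  fixes E :: "pt set \<Rightarrow> real"
  assumes conf: "conforming_triangulation \<Omega> Th" and E: "\<And>T. T \<in> Th \<Longrightarrow> 0 \<le> E T"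
    and N: "\<And>z. real (card {T\<in>Th. z \<in> T}) \<le> N"
  shows "(\<Sum>T\<in>Th. \<Sum>z\<in>T. \<Sum>T'\<in>{T'\<in>Th. z \<in> T'}. E T') \<le> 3 * N * (\<Sum>T\<in>Th. E T)"
proof -
  have fin: "finite Th" using conf by (simp add: conforming_triangulation_def)
  have card3: "card T = 3" if "T \<in> Th" for T using conforming_triangle[OF conf that] by (simp add: triangle_def)
  then have finT: "finite T" if "T \<in> Th" for T using that by (simp add: card_ge_0_finite)
  have ind: "(\<Sum>T'\<in>{T'\<in>Th. z \<in> T'}. E T') = (\<Sum>T'\<in>Th. if z \<in> T' then E T' else 0)" for z
    using fin by (simp add: sum.inter_filter)
  have "(\<Sum>T\<in>Th. \<Sum>z\<in>T. \<Sum>T'\<in>{T'\<in>Th. z \<in> T'}. E T')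
      = (\<Sum>T\<in>Th. \<Sum>T'\<in>Th. \<Sum>z\<in>T. if z \<in> T' then E T' else 0)"
    unfolding ind by (intro sum.cong refl sum.swap)
  also have "\<dots> = (\<Sum>T'\<in>Th. \<Sum>T\<in>Th. \<Sum>z\<in>T. if z \<in> T' then E T' else 0)" by (rule sum.swap)
  \<comment> \<open>Both inner sums run over the common vertices of \<open>T\<close> and
    \<open>T'\<close>.\<close>
  also have "\<dots> = (\<Sum>T'\<in>Th. \<Sum>T\<in>Th. \<Sum>z\<in>T'. if z \<in> T then E T' else 0)"
  proof (rule sum.cong[OF refl], rule sum.cong[OF refl])
    fix T' T assume "T' \<in> Th" "T \<in> Th"
    then show "(\<Sum>z\<in>T. if z \<in> T' then E T' else 0) = (\<Sum>z\<in>T'. if z \<in> T then E T' else 0)"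
      using finT by (simp add: sum.inter_restrict[symmetric] Int_commute)
  qed
  also have "\<dots> = (\<Sum>T'\<in>Th. \<Sum>z\<in>T'. \<Sum>T\<in>Th. if z \<in> T then E T' else 0)"
    by (intro sum.cong refl sum.swap)
  also have "\<dots> = (\<Sum>T'\<in>Th. \<Sum>z\<in>T'. real (card {T\<in>Th. z \<in> T}) * E T')"
    using fin by (simp add: sum.inter_filter[symmetric])
  also have "\<dots> \<le> (\<Sum>T'\<in>Th. \<Sum>z\<in>T'. N * E T')"
    by (intro sum_mono mult_right_mono N E)
  also have "\<dots> = 3 * N * (\<Sum>T\<in>Th. E T)"
    by (simp add: card3 sum_distrib_left mult.assoc)
  finally show ?thesis .
qed

text \<open>The gradient of the interpolant is compared with that of the local solution U. Their
  difference is the gradient of an affine function whose vertex values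
  \<open>nodal_average_close\<close> bounds by the energy of the vertex patches. The factor 384 is 2
  * 64 from \<open>gradient_inverse_estimate\<close>, times 3 from
  \<open>sum_vertex_patches_le\<close>.\<close>

lemma interpolant_gradient_energy:
  assumes conf: "conforming_triangulation \<Omega> Th" and "open \<Omega>"
    and reg: "shape_regular \<sigma> Th" "quasi_uniform \<kappa> Th" and pos: "\<sigma> > 0" "\<kappa> > 0" "c1 > 0"
    and \<tau>: "c1 / mesh_size Th \<le> \<tau>" and mu: "mu \<in> M0space \<Omega> Th"
    and G: "\<And>T. T \<in> Th \<Longrightarrow> \<forall>z\<in>T. IW_nodal Th mu z = G T \<bullet> z + K T"
  defines "N \<equiv> 8 * \<sigma>\<^sup>2 * \<kappa>\<^sup>2" and "\<gamma> \<equiv> c1 / \<kappa>"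
  shows "(\<Sum>T\<in>Th. area T * (G T \<bullet> G T))
    \<le> (2 * (2 + 12 * \<sigma>\<^sup>2 / \<gamma>) + 384 * \<sigma>\<^sup>2 * (4 * N\<^sup>2 + 3)\<^sup>2 * (6 * \<sigma>\<^sup>2 / \<gamma>) * N) * ahat \<tau> Th mu mu"
proof -
  let ?E = "\<lambda>T. local_energy \<tau> T mu" and ?f = "IW_nodal Th mu"
  let ?D = "\<lambda>z. \<Sum>T'\<in>{T'\<in>Th. z \<in> T'}. ?E T'"
  define c where "c = 6 * \<sigma>\<^sup>2 / \<gamma>"
  define b where "b = 4 * N\<^sup>2 + 3"
  have fin: "finite Th" using conf by (simp add: conforming_triangulation_def)
  have tri: "triangle T" if "T \<in> Th" for T using conforming_triangle[OF conf that] .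
  have H: "mesh_size Th > 0" using mesh_size_pos[OF conf] .
  have \<tau>0: "\<tau> > 0" using \<tau> H pos by (smt (verit) divide_pos_pos)
  have \<gamma>: "\<gamma> > 0" using pos by (simp add: \<gamma>_def)
  have c0: "c \<ge> 0" using \<gamma> by (simp add: c_def)
  have sr: "elem_diam T \<le> \<sigma> * inradius T" if "T \<in> Th" for T using reg that by (simp add: shape_regular_def)
  \<comment> \<open>Quasi-uniformity converts the global mesh size in the bound on \<tau> into the
    diameter of the element, at the price of \<kappa>.\<close>
  have \<gamma>h: "\<gamma> \<le> \<tau> * elem_diam T" if "T \<in> Th" for T
  proof -
    have "mesh_size Th \<le> \<kappa> * elem_diam T" using reg that by (simp add: quasi_uniform_def)
    then have "\<gamma> \<le> c1 / mesh_size Th * elem_diam T"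
      using H pos by (simp add: \<gamma>_def field_simps)
    also have "\<dots> \<le> \<tau> * elem_diam T"
      using \<tau> elem_diam_pos[OF tri[OF that]] by (intro mult_right_mono) auto
    finally show ?thesis .
  qed
  have ea: "edgewise_affine T mu" if "T \<in> Th" for T using M0space_edgewise_affine[OF mu that] .
  have E0: "?E T \<ge> 0" for T using local_energy_nonneg[OF \<tau>0] .
  have D0: "?D z \<ge> 0" for z by (intro sum_nonneg E0)
  have N: "real (card {T\<in>Th. z \<in> T}) \<le> N" for z unfolding N_def by (rule card_star_le[OF conf reg pos(1,2)])
  have dev: "\<bar>?f z - lsU \<tau> T mu z\<bar> \<le> b * sqrt (c * ?D z)" if T: "T \<in> Th" "z \<in> T" for T z
    unfolding IW_nodal_def b_def
  proof (rule nodal_average_close[OF conf \<open>open \<Omega>\<close> _ _ N T, where u = "\<lambda>T. lsU \<tau> T mu z"])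
    fix T e assume h: "T \<in> Th" "e \<in> tri_edges T" "z \<in> e"
    then have zT: "z \<in> T" by (auto simp: tri_edges_def)
    have "(lsU \<tau> T mu z - mu e z)\<^sup>2 \<le> c * ?E T"
      unfolding c_def by (rule vertex_energy_estimate[OF tri[OF h(1)] pos(1) sr[OF h(1)] \<tau>0 \<gamma> \<gamma>h[OF h(1)] ea[OF h(1)] h(2,3)])
    also have "\<dots> \<le> c * ?D z"
      using fin h zT c0 E0 by (intro mult_left_mono member_le_sum) auto
    finally show "\<bar>lsU \<tau> T mu z - mu e z\<bar> \<le> sqrt (c * ?D z)" by (simp add: real_le_rsqrt)
  next
    fix e assume h: "e \<in> edges Th" "z \<in> e" "convex hull e \<subseteq> frontier \<Omega>"
    then show "mu e z = 0" using mu by (auto simp: M0space_def hull_inc)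
  qed
  have elem: "area T * (G T \<bullet> G T) \<le> 2 * (2 + 12 * \<sigma>\<^sup>2 / \<gamma>) * ?E T + 128 * \<sigma>\<^sup>2 * b\<^sup>2 * c * (\<Sum>z\<in>T. ?D z)"
    if T: "T \<in> Th" for T
  proof -
    have finT: "finite T" using tri[OF T] by (simp add: triangle_def card_ge_0_finite)
    have "lsU \<tau> T mu \<in> P1"
      using local_solver_eqs[OF tri[OF T] \<tau>0, of mu] edgewise_affine_continuous[OF ea[OF T]] by (simp add: local_eqs_def)
    then obtain g k where U: "lsU \<tau> T mu = (\<lambda>x. g \<bullet> x + k)" by (rule P1_param)
    have 1: "area T * (g \<bullet> g) \<le> (2 + 12 * \<sigma>\<^sup>2 / \<gamma>) * ?E T"
      by (rule grad_energy_estimate[OF tri[OF T] pos(1) sr[OF T] \<tau>0 \<gamma> \<gamma>h[OF T] ea[OF T] U])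
    let ?S = "\<Sum>z\<in>T. ?D z"
    have S0: "?S \<ge> 0" by (intro sum_nonneg D0)
    have "area T * ((G T - g) \<bullet> (G T - g)) \<le> 64 * \<sigma>\<^sup>2 * (b * sqrt (c * ?S))\<^sup>2"
    proof (rule gradient_inverse_estimate[OF tri[OF T] pos(1) sr[OF T]])
      fix z assume z: "z \<in> T"
      have "(G T - g) \<bullet> z + (K T - k) = ?f z - lsU \<tau> T mu z"
        using G[OF T] z U by (simp add: inner_diff_left)
      \<comment> \<open>\<open>gradient_inverse_estimate\<close> takes a single bound for all three
        vertices, so the patch energy at \<open>z\<close> is replaced by the sum over the
        vertices.\<close>
      moreover have "b * sqrt (c * ?D z) \<le> b * sqrt (c * ?S)"
        using finT z c0 D0 unfolding b_def
        by (intro mult_left_mono real_sqrt_le_mono member_le_sum[where f = "\<lambda>z. ?D z"]) auto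
      ultimately show "\<bar>(G T - g) \<bullet> z + (K T - k)\<bar> \<le> b * sqrt (c * ?S)" using dev[OF T z] by linarith
    qed
    also have "\<dots> = 64 * \<sigma>\<^sup>2 * b\<^sup>2 * c * ?S" using c0 S0 by (simp add: power_mult_distrib)
    finally have 2: "area T * ((G T - g) \<bullet> (G T - g)) \<le> 64 * \<sigma>\<^sup>2 * b\<^sup>2 * c * ?S" .
    have "G T \<bullet> G T \<le> 2 * (g \<bullet> g) + 2 * ((G T - g) \<bullet> (G T - g))"
    proof -
      \<comment> \<open>The difference of the two sides of the claim is exactly this square.\<close>
      have "0 \<le> (G T - 2 *\<^sub>R g) \<bullet> (G T - 2 *\<^sub>R g)" by simp
      then show ?thesis by (simp add: inner_diff_left inner_diff_right inner_commute)
    qed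
    then have "area T * (G T \<bullet> G T) \<le> area T * (2 * (g \<bullet> g) + 2 * ((G T - g) \<bullet> (G T - g)))"
      by (intro mult_left_mono) (simp_all add: area_def)
    then have "area T * (G T \<bullet> G T) \<le> 2 * (area T * (g \<bullet> g)) + 2 * (area T * ((G T - g) \<bullet> (G T - g)))"
      by (simp add: distrib_left mult.left_commute)
    then show ?thesis using 1 2 by linarith
  qed
  have "(\<Sum>T\<in>Th. area T * (G T \<bullet> G T))
      \<le> (\<Sum>T\<in>Th. 2 * (2 + 12 * \<sigma>\<^sup>2 / \<gamma>) * ?E T + 128 * \<sigma>\<^sup>2 * b\<^sup>2 * c * (\<Sum>z\<in>T. ?D z))"
    by (intro sum_mono elem)
  also have "\<dots> = 2 * (2 + 12 * \<sigma>\<^sup>2 / \<gamma>) * (\<Sum>T\<in>Th. ?E T) + 128 * \<sigma>\<^sup>2 * b\<^sup>2 * c * (\<Sum>T\<in>Th. \<Sum>z\<in>T. ?D z)"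
    by (simp only: sum.distrib sum_distrib_left)
  also have "\<dots> \<le> 2 * (2 + 12 * \<sigma>\<^sup>2 / \<gamma>) * (\<Sum>T\<in>Th. ?E T) + 128 * \<sigma>\<^sup>2 * b\<^sup>2 * c * (3 * N * (\<Sum>T\<in>Th. ?E T))"
    using c0 by (intro add_left_mono mult_left_mono sum_vertex_patches_le[OF conf E0 N]) simp
  also have "\<dots> = (2 * (2 + 12 * \<sigma>\<^sup>2 / \<gamma>) + 384 * \<sigma>\<^sup>2 * b\<^sup>2 * c * N) * (\<Sum>T\<in>Th. ?E T)"
    by (simp add: algebra_simps)
  finally show ?thesis unfolding ahat_diag b_def c_def .
qed

text \<open>On a fine triangle the transferred trace is one affine function, that of its coarse
  parent, so \<open>local_solver_affine\<close> makes the local energy equal to area times squared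
  gradient. It remains to collect the fine triangles by parent.\<close>

lemma ahat_transfer_le:
  assumes conf: "conforming_triangulation \<Omega> Th" "conforming_triangulation \<Omega> Th'" and ref: "refines Th' Th" and \<tau>: "\<tau> > 0"
    and G: "\<And>T. T \<in> Th \<Longrightarrow> \<forall>z\<in>T. IW_nodal Th mu z = G T \<bullet> z + K T"
  shows "ahat \<tau> Th' (transfer Th mu) (transfer Th mu) \<le> (\<Sum>T\<in>Th. area T * (G T \<bullet> G T))"
proof -
  have fin: "finite Th" "finite Th'" using conf by (auto simp: conforming_triangulation_def)
  \<comment> \<open>One parent is fixed for each fine triangle, so that the fine sum can be grouped
    without overlap.\<close>
  obtain P where P: "\<And>T'. T' \<in> Th' \<Longrightarrow> P T' \<in> Th \<and> convex hull T' \<subseteq> convex hull (P T')"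
    using ref unfolding refines_def by metis
  have E: "local_energy \<tau> T' (transfer Th mu) = area T' * (G (P T') \<bullet> G (P T'))" if T': "T' \<in> Th'" for T'
  proof -
    have tri: "triangle T'" using conforming_triangle[OF conf(2) T'] .
    have m: "transfer Th mu e x = G (P T') \<bullet> x + K (P T')" if "e \<in> tri_edges T'" "x \<in> convex hull e" for e x
    proof -
      have "convex hull e \<subseteq> convex hull T'" using that by (intro hull_mono) (auto simp: tri_edges_def)
      then have "x \<in> convex hull (P T')" using that P[OF T'] by blast
      then show ?thesis
        unfolding transfer_def IW_def using p1_interp_eq[OF conf(1)] G P[OF T'] by blast
    qed
    note sol = local_solver_affine[OF tri \<tau> m]
    have "bdry_int T' (\<lambda>e x. (lsU \<tau> T' (transfer Th mu) x - transfer Th mu e x) * (lsU \<tau> T' (transfer Th mu) x - transfer Th mu e x))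
        = bdry_int T' (\<lambda>e x. 0 * 0)"
      by (rule bdry_int_cong) (simp add: sol m)
    also have "\<dots> = 0" by (subst bdry_int_cmult) simp
    finally show ?thesis by (simp add: local_energy_def sol elem_int_const[OF tri])
  qed
  have "ahat \<tau> Th' (transfer Th mu) (transfer Th mu) = (\<Sum>T'\<in>Th'. area T' * (G (P T') \<bullet> G (P T')))"
    unfolding ahat_diag by (intro sum.cong refl E)
  also have "\<dots> = (\<Sum>T\<in>Th. \<Sum>T'\<in>{T'\<in>Th'. P T' = T}. area T' * (G (P T') \<bullet> G (P T')))"
    by (rule sum.group[symmetric]) (use fin P in auto)
  also have "\<dots> = (\<Sum>T\<in>Th. (\<Sum>T'\<in>{T'\<in>Th'. P T' = T}. area T') * (G T \<bullet> G T))"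
    by (simp add: sum_distrib_right)
  \<comment> \<open>The children of \<open>T\<close> are triangles of a conforming mesh inside its
    hull, so their areas add up to at most \<open>area T\<close>.\<close>
  also have "\<dots> \<le> (\<Sum>T\<in>Th. area T * (G T \<bullet> G T))"
  proof (intro sum_mono mult_right_mono)
    fix T assume "T \<in> Th"
    then show "(\<Sum>T'\<in>{T'\<in>Th'. P T' = T}. area T') \<le> area T"
      unfolding area_def[of T] using P compact_triangle conforming_triangle[OF conf(1)]
      by (intro sum_area_le[OF conf(2)]) auto
  qed simp
  finally show ?thesis .
qed

section \<open>Nested levels and the uniform constant\<close>

lemma refines_refl: "refines Th Th"
  by (auto simp: refines_def)

lemma refines_trans: "refines A B \<Longrightarrow> refines B C \<Longrightarrow> refines A C"
  unfolding refines_def by (meson subset_trans)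

lemma refines_chain:
  fixes L l :: nat
  assumes "\<forall>k\<in>{1..L}. refines (Th k) (Th (k - 1))" "l \<le> L"
  shows "refines (Th L) (Th l)"
  using assms(2,1)
proof (induction L rule: dec_induct)
  case base show ?case by (rule refines_refl)
next
  case (step n)
  then have "refines (Th n) (Th l)" by auto
  moreover have "refines (Th (Suc n)) (Th n)" using step.prems by force
  ultimately show ?case using refines_trans by blast
qed

theorem theorem3p5:
  fixes \<sigma> \<kappa> c1 c2 :: real and \<Omega> :: "pt set"
  assumes "polygonal_domain \<Omega>" and "\<sigma> > 0" and "\<kappa> > 0" and "c1 > 0" and "c2 > 0"
  shows "\<exists>C. \<forall>(Th :: nat \<Rightarrow> pt set set) (\<tau> :: nat \<Rightarrow> real) (L::nat) (l::nat) mu.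
     (\<forall>k\<le>L. conforming_triangulation \<Omega> (Th k) \<and> shape_regular \<sigma> (Th k)
            \<and> quasi_uniform \<kappa> (Th k)
            \<and> c1 / mesh_size (Th k) \<le> \<tau> k \<and> \<tau> k \<le> c2 / mesh_size (Th k))
     \<and> (\<forall>k\<in>{1..L}. refines (Th k) (Th (k - 1)))
     \<and> l < L \<and> mu \<in> M0space \<Omega> (Th l)
     \<longrightarrow> ahat (\<tau> L) (Th L) (transfer (Th l) mu) (transfer (Th l) mu)
           \<le> C * ahat (\<tau> l) (Th l) mu mu"
proof -
  define N where "N = 8 * \<sigma>\<^sup>2 * \<kappa>\<^sup>2"
  define \<gamma> where "\<gamma> = c1 / \<kappa>"
  have "open \<Omega>" using assms(1) by (simp add: polygonal_domain_def)
  show ?thesis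
  \<comment> \<open>The witness is the constant of \<open>interpolant_gradient_energy\<close>; it is
    built from data fixed before the meshes and levels are quantified.\<close>
  proof (intro exI[of _ "2 * (2 + 12 * \<sigma>\<^sup>2 / \<gamma>) + 384 * \<sigma>\<^sup>2 * (4 * N\<^sup>2 + 3)\<^sup>2 * (6 * \<sigma>\<^sup>2 / \<gamma>) * N"] allI impI, elim conjE)
    fix Th :: "nat \<Rightarrow> pt set set" and \<tau> :: "nat \<Rightarrow> real" and L l :: nat and mu
    assume lev: "\<forall>k\<le>L. conforming_triangulation \<Omega> (Th k) \<and> shape_regular \<sigma> (Th k)
            \<and> quasi_uniform \<kappa> (Th k)
            \<and> c1 / mesh_size (Th k) \<le> \<tau> k \<and> \<tau> k \<le> c2 / mesh_size (Th k)"
      and nested: "\<forall>k\<in>{1..L}. refines (Th k) (Th (k - 1))"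
      and "l < L" and mu: "mu \<in> M0space \<Omega> (Th l)"
    have L: "conforming_triangulation \<Omega> (Th L)" "c1 / mesh_size (Th L) \<le> \<tau> L" using lev by auto
    have l: "conforming_triangulation \<Omega> (Th l)" "shape_regular \<sigma> (Th l)" "quasi_uniform \<kappa> (Th l)"
      "c1 / mesh_size (Th l) \<le> \<tau> l" using lev \<open>l < L\<close> by auto
    have "\<tau> L > 0" using L(2) mesh_size_pos[OF L(1)] \<open>c1 > 0\<close> by (smt (verit) divide_pos_pos)
    have "refines (Th L) (Th l)" using refines_chain[OF nested] \<open>l < L\<close> by simp
    \<comment> \<open>The gradients and constants of the interpolant on the coarse triangles are
      chosen once and shared by the two estimates.\<close>
    have "\<forall>T\<in>Th l. \<exists>g k. \<forall>z\<in>T. IW_nodal (Th l) mu z = g \<bullet> z + k"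
      using affine_interpolant_ex conforming_triangle[OF l(1)] by blast
    from bchoice[OF this] obtain G where "\<forall>T\<in>Th l. \<exists>k. \<forall>z\<in>T. IW_nodal (Th l) mu z = G T \<bullet> z + k" by blast
    from bchoice[OF this] obtain K where G: "\<And>T. T \<in> Th l \<Longrightarrow> \<forall>z\<in>T. IW_nodal (Th l) mu z = G T \<bullet> z + K T"
      by blast
    have "ahat (\<tau> L) (Th L) (transfer (Th l) mu) (transfer (Th l) mu) \<le> (\<Sum>T\<in>Th l. area T * (G T \<bullet> G T))"
      by (rule ahat_transfer_le[OF l(1) L(1) \<open>refines (Th L) (Th l)\<close> \<open>\<tau> L > 0\<close> G])
    also have "\<dots> \<le> (2 * (2 + 12 * \<sigma>\<^sup>2 / \<gamma>) + 384 * \<sigma>\<^sup>2 * (4 * N\<^sup>2 + 3)\<^sup>2 * (6 * \<sigma>\<^sup>2 / \<gamma>) * N) * ahat (\<tau> l) (Th l) mu mu"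
      unfolding N_def \<gamma>_def
      by (rule interpolant_gradient_energy[OF l(1) \<open>open \<Omega>\<close> l(2,3) assms(2,3,4) l(4) mu G])
    finally show "ahat (\<tau> L) (Th L) (transfer (Th l) mu) (transfer (Th l) mu)
      \<le> (2 * (2 + 12 * \<sigma>\<^sup>2 / \<gamma>) + 384 * \<sigma>\<^sup>2 * (4 * N\<^sup>2 + 3)\<^sup>2 * (6 * \<sigma>\<^sup>2 / \<gamma>) * N) * ahat (\<tau> l) (Th l) mu mu" .
  qed
qed

end
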